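(* Let $A/B$ be a depth two (D2) ring extension such that the natural right $B$-module $A_B$ is finitely generated projective. Let $R = C_A(B)$ be the centralizer of $B$ in $A$ and let $\mathcal{S} = (S, \Delta, \varepsilon)$ be the $R$-coring with $S = \mathrm{End}({}_BA_B)$ described in the context. Then $A/B$ is a separable extension if and only if the $R$-coring $\mathcal{S}$ is coseparable.
   Context: Rings are associative and unital; $B$ is a unital subring of $A$. $R = C_A(B) = \{r \in A : rb = br \text{ for all } b\in B\}$. Depth two: $A/B$ is D2 if $A\otimes_B A$ is isomorphic to a direct summand of a finite direct sum $A \oplus\cdots\oplus A$ as $B$-$A$-bimodules and also as $A$-$B$-bimodules (natural bimodule structures). Put $S := \mathrm{End}({}_BA_B)$ and $T := (A\otimes_B A)^B=\{t : bt=tb\ \forall b\in B\}$. Equivalently, there are finitely many $\beta_i\in S$, $t_i\in T$ with $a\otimes a' = \sum_i t_i\beta_i(a)a'$, and finitely many $\gamma_j\in S$, $u_j\in T$ with $a\otimes a' = \sum_j a\gamma_j(a')u_j$, for all $a,a'\in A$. Coring: for a ring $R'$, an $R'$-coring is an $R'$-$R'$-bimodule $\mathcal{C}$ with $R'$-$R'$-bimodule maps $\Delta:\mathcal{C}\to\mathcal{C}\otimes_{R'}\mathcal{C}$ (coassociative, written $\Delta(c) = c_{(1)}\otimes c_{(2)}$) and $\varepsilon:\mathcal{C}\to R'$ (counit). The $R$-coring $\mathcal{S}$: the bimodule structure on $S$ is $(r\cdot\alpha\cdot r')(a) = r\alpha(a)r'$ for $r,r'\in R$, $\alpha\in S$,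 $a\in A$. The coproduct is $\Delta(\alpha) = \sum_i \alpha(\,?\,t_i^1)t_i^2\otimes_R\beta_i$ (where $t_i = t_i^1\otimes t_i^2$, summation suppressed); equivalently, under the isomorphism $S\otimes_R S\cong \mathrm{Hom}_{B\text{-}B}(A\otimes_B A, A)$, $\alpha\otimes\beta\mapsto(a\otimes a'\mapsto\alpha(a)\beta(a'))$, it is $\Delta(\alpha)(a\otimes a') = \alpha(aa')$. The counit is $\varepsilon(\alpha) = \alpha(1)$. An $R'$-coring $\mathcal{C}$ is coseparable if there is an $R'$-$R'$-bimodule homomorphism $\gamma:\mathcal{C}\otimes_{R'}\mathcal{C}\to R'$ such that $\gamma(c_{(1)}\otimes c_{(2)}) = \varepsilon(c)$ and $c_{(1)}\gamma(c_{(2)}\otimes c') = \gamma(c\otimes c'_{(1)})c'_{(2)}$ for all $c,c'\in\mathcal{C}$. $A/B$ is a separable extension if there is $e = e^1\otimes e^2\in A\otimes_B A$ (summation suppressed) with $ae = ea$ for all $a\in A$ and $e^1e^2 = 1$. *)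

theory Defs
  imports "HOL-Library.Poly_Mapping" "HOL-Library.Function_Algebras" "HOL-Library.Set_Algebras"
begin

text \<open>
  The big ring \<open>A\<close> is a type of sort \<open>{ring, monoid_mult}\<close>: associative and unital, but, unlike
  \<open>ring_1\<close>, without the requirement \<open>0 \<noteq> 1\<close>. Subrings of \<open>A\<close> are sets.
\<close>

definition unital_subring :: "'a::{ring,monoid_mult} set \<Rightarrow> bool" where
  "unital_subring B \<longleftrightarrow> 1 \<in> B \<and> (\<forall>x\<in>B. \<forall>y\<in>B. x - y \<in> B \<and> x * y \<in> B)"

definition centralizer :: "'a::{ring,monoid_mult} set \<Rightarrow> 'a set" where
  "centralizer B = {r. \<forall>b\<in>B. r * b = b * r}"


section \<open>Bimodules and tensor products over noncommutative rings\<close>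

text \<open>
  The addition of a bimodule is the \<open>+\<close> of its type. A right module is treated as a bimodule whose
  set of left scalars is empty. The bimodule axioms are not part of the record; all instances below
  satisfy them.
\<close>

record ('l, 'm, 'r) bimodule =
  lring :: "'l set"
  carr :: "'m set"
  rring :: "'r set"
  lact :: "'l \<Rightarrow> 'm \<Rightarrow> 'm"
  ract :: "'m \<Rightarrow> 'r \<Rightarrow> 'm"

definition bimodule_hom ::
  "('l, 'm::plus, 'r, 'x) bimodule_scheme \<Rightarrow> ('l, 'n::plus, 'r, 'y) bimodule_scheme \<Rightarrow> ('m \<Rightarrow> 'n) set" where
  "bimodule_hom M N = {f.
     (\<forall>x\<in>carr M. f x \<in> carr N) \<and>
     (\<forall>x\<in>carr M. \<forall>y\<in>carr M. f (x + y) = f x + f y) \<and>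
     (\<forall>l\<in>lring M. \<forall>x\<in>carr M. f (lact M l x) = lact N l (f x)) \<and>
     (\<forall>x\<in>carr M. \<forall>r\<in>rring M. f (ract M x r) = ract N (f x) r)}"

definition bimodule_iso ::
  "('l, 'm::plus, 'r, 'x) bimodule_scheme \<Rightarrow> ('l, 'n::plus, 'r, 'y) bimodule_scheme \<Rightarrow> bool" where
  "bimodule_iso M N \<longleftrightarrow> (\<exists>f\<in>bimodule_hom M N. bij_betw f (carr M) (carr N))"

definition subbimodule ::
  "'m::ab_group_add set \<Rightarrow> ('l, 'm, 'r, 'x) bimodule_scheme \<Rightarrow> bool" where
  "subbimodule P M \<longleftrightarrow> P \<subseteq> carr M \<and> 0 \<in> P \<and> (\<forall>x\<in>P. \<forall>y\<in>P. x - y \<in> P) \<and>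
     (\<forall>l\<in>lring M. \<forall>x\<in>P. lact M l x \<in> P) \<and> (\<forall>x\<in>P. \<forall>r\<in>rring M. ract M x r \<in> P)"

definition iso_to_direct_summand ::
  "('l, 'm::plus, 'r, 'x) bimodule_scheme \<Rightarrow> ('l, 'n::ab_group_add, 'r, 'y) bimodule_scheme \<Rightarrow> bool" where
  "iso_to_direct_summand M N \<longleftrightarrow>
     (\<exists>P Q. subbimodule P N \<and> subbimodule Q N \<and> P \<inter> Q = {0} \<and> P + Q = carr N \<and>
            bimodule_iso M (N\<lparr>carr := P\<rparr>))"

text \<open>The direct sum of \<open>n\<close> copies of \<open>M\<close>; vectors are padded by \<open>0\<close> beyond index \<open>n\<close>.\<close>

definition copies ::
  "nat \<Rightarrow> ('l, 'm::zero, 'r, 'x) bimodule_scheme \<Rightarrow> ('l, nat \<Rightarrow> 'm, 'r) bimodule" where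
  "copies n M = \<lparr>lring = lring M,
     carr = {v. (\<forall>i<n. v i \<in> carr M) \<and> (\<forall>i\<ge>n. v i = 0)}, rring = rring M,
     lact = (\<lambda>l v i. if i < n then lact M l (v i) else 0),
     ract = (\<lambda>v r i. if i < n then ract M (v i) r else 0)\<rparr>"

text \<open>
  \<open>M \<otimes> N\<close> over \<open>rring M\<close> is the free abelian group on \<open>carr M \<times> carr N\<close> modulo the subgroup
  \<open>tensor_rels M N\<close>. Its elements are cosets, so its addition is the \<open>+\<close> of sets and its zero is
  \<open>tensor_rels M N\<close> itself (not the set \<open>0 = {0}\<close>).
\<close>

inductive_set tensor_rels ::
  "('l, 'm::plus, 'r, 'x) bimodule_scheme \<Rightarrow> ('r, 'n::plus, 's, 'y) bimodule_scheme \<Rightarrow> ('m \<times> 'n \<Rightarrow>\<^sub>0 int) set"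
  for M N where
  zero: "0 \<in> tensor_rels M N"
| diff: "\<lbrakk>x \<in> tensor_rels M N; y \<in> tensor_rels M N\<rbrakk> \<Longrightarrow> x - y \<in> tensor_rels M N"
| add_left: "\<lbrakk>m \<in> carr M; m' \<in> carr M; n \<in> carr N\<rbrakk> \<Longrightarrow>
    frag_of (m + m', n) - frag_of (m, n) - frag_of (m', n) \<in> tensor_rels M N"
| add_right: "\<lbrakk>m \<in> carr M; n \<in> carr N; n' \<in> carr N\<rbrakk> \<Longrightarrow>
    frag_of (m, n + n') - frag_of (m, n) - frag_of (m, n') \<in> tensor_rels M N"
| balanced: "\<lbrakk>m \<in> carr M; r \<in> rring M; n \<in> carr N\<rbrakk> \<Longrightarrow>
    frag_of (ract M m r, n) - frag_of (m, lact N r n) \<in> tensor_rels M N"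

definition pure_tensor ::
  "('l, 'm::plus, 'r, 'x) bimodule_scheme \<Rightarrow> ('r, 'n::plus, 's, 'y) bimodule_scheme \<Rightarrow> 'm \<Rightarrow> 'n \<Rightarrow> ('m \<times> 'n \<Rightarrow>\<^sub>0 int) set" where
  "pure_tensor M N m n = frag_of (m, n) +o tensor_rels M N"

definition tensor ::
  "('l, 'm::plus, 'r, 'x) bimodule_scheme \<Rightarrow> ('r, 'n::plus, 's, 'y) bimodule_scheme \<Rightarrow> ('l, ('m \<times> 'n \<Rightarrow>\<^sub>0 int) set, 's) bimodule" where
  "tensor M N = \<lparr>lring = lring M,
     carr = {x +o tensor_rels M N |x. Poly_Mapping.keys x \<subseteq> carr M \<times> carr N},
     rring = rring N,
     lact = (\<lambda>l X. frag_extend (\<lambda>(m, n). frag_of (lact M l m, n)) ` X + tensor_rels M N),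
     ract = (\<lambda>X s. frag_extend (\<lambda>(m, n). frag_of (m, ract N n s)) ` X + tensor_rels M N)\<rparr>"

definition int_scale :: "int \<Rightarrow> 'k::ab_group_add \<Rightarrow> 'k" where
  "int_scale k x = (\<Sum>i<nat k. x) - (\<Sum>i<nat (- k). x)"

definition free_lift :: "('b \<Rightarrow> 'k::ab_group_add) \<Rightarrow> ('b \<Rightarrow>\<^sub>0 int) \<Rightarrow> 'k" where
  "free_lift f x = (\<Sum>b\<in>Poly_Mapping.keys x. int_scale (Poly_Mapping.lookup x b) (f b))"

text \<open>
  The additive map \<open>x \<otimes> y \<mapsto> f x y\<close> induced by a balanced biadditive map \<open>f\<close>. For such \<open>f\<close> the image
  of a coset is a singleton.
\<close>

definition tensor_lift :: "('m \<Rightarrow> 'n \<Rightarrow> 'k::ab_group_add) \<Rightarrow> ('m \<times> 'n \<Rightarrow>\<^sub>0 int) set \<Rightarrow> 'k" where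
  "tensor_lift f X = the_elem (free_lift (case_prod f) ` X)"


section \<open>Ring extensions\<close>

text \<open>A subset of the ring \<open>A\<close> as a bimodule via multiplication in \<open>A\<close>.\<close>

definition mult_bimodule ::
  "'a::{ring,monoid_mult} set \<Rightarrow> 'a set \<Rightarrow> 'a set \<Rightarrow> ('a, 'a, 'a) bimodule" where
  "mult_bimodule L M R = \<lparr>lring = L, carr = M, rring = R, lact = (*), ract = (*)\<rparr>"

text \<open>\<open>A \<otimes>\<^sub>B A\<close> as an \<open>L\<close>-\<open>R\<close>-bimodule.\<close>

definition AA :: "'a::{ring,monoid_mult} set \<Rightarrow> 'a set \<Rightarrow> 'a set \<Rightarrow> ('a, ('a \<times> 'a \<Rightarrow>\<^sub>0 int) set, 'a) bimodule" where
  "AA L B R = tensor (mult_bimodule L UNIV B) (mult_bimodule B UNIV R)"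

definition depth_two :: "'a::{ring,monoid_mult} set \<Rightarrow> bool" where
  "depth_two B \<longleftrightarrow>
     (\<exists>n. iso_to_direct_summand (AA B B UNIV) (copies n (mult_bimodule B UNIV UNIV))) \<and>
     (\<exists>n. iso_to_direct_summand (AA UNIV B B) (copies n (mult_bimodule UNIV UNIV B)))"

text \<open>\<open>A\<^sub>B\<close> is isomorphic to a direct summand of some \<open>B\<^sup>n\<close>.\<close>

definition right_fg_projective :: "'a::{ring,monoid_mult} set \<Rightarrow> bool" where
  "right_fg_projective B \<longleftrightarrow>
     (\<exists>n. iso_to_direct_summand (mult_bimodule {} UNIV B) (copies n (mult_bimodule {} B B)))"

definition separable_extension :: "'a::{ring,monoid_mult} set \<Rightarrow> bool" where
  "separable_extension B \<longleftrightarrow>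
     (\<exists>e\<in>carr (AA UNIV B UNIV).
        (\<forall>a. lact (AA UNIV B UNIV) a e = ract (AA UNIV B UNIV) e a) \<and> tensor_lift (*) e = 1)"


section \<open>Coseparable corings\<close>

text \<open>An \<open>R\<close>-coring has \<open>lring = rring = R\<close>; the scalar ring \<open>R\<close> is a subset of a type of rings.\<close>

record ('r, 'c) coring = "('r, 'c, 'r) bimodule" +
  comult :: "'c \<Rightarrow> ('c \<times> 'c \<Rightarrow>\<^sub>0 int) set"
  counit :: "'c \<Rightarrow> 'r"

text \<open>
  In the second condition, \<open>c\<^sub>1 \<gamma>(c\<^sub>2 \<otimes> c')\<close> is the image of \<open>\<Delta> c\<close> under the additive map
  \<open>x \<otimes> y \<mapsto> x \<gamma>(y \<otimes> c')\<close>, and likewise on the other side.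
\<close>

definition coseparable :: "('r::{ring,monoid_mult}, 'c::ab_group_add, 'x) coring_scheme \<Rightarrow> bool" where
  "coseparable C \<longleftrightarrow>
     (\<exists>\<gamma>\<in>bimodule_hom (tensor C C) (mult_bimodule (lring C) (lring C) (rring C)).
        (\<forall>c\<in>carr C. \<gamma> (comult C c) = counit C c) \<and>
        (\<forall>c\<in>carr C. \<forall>c'\<in>carr C.
           tensor_lift (\<lambda>x y. ract C x (\<gamma> (pure_tensor C C y c'))) (comult C c) =
           tensor_lift (\<lambda>x y. lact C (\<gamma> (pure_tensor C C c x)) y) (comult C c')))"


section \<open>The coring of bimodule endomorphisms\<close>

definition End_BAB :: "'a::{ring,monoid_mult} set \<Rightarrow> ('a \<Rightarrow> 'a) set" where
  "End_BAB B = bimodule_hom (mult_bimodule B UNIV B) (mult_bimodule B UNIV B)"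

definition S_bimodule :: "'a::{ring,monoid_mult} set \<Rightarrow> ('a, 'a \<Rightarrow> 'a, 'a) bimodule" where
  "S_bimodule B = \<lparr>lring = centralizer B, carr = End_BAB B, rring = centralizer B,
     lact = (\<lambda>r \<alpha> a. r * \<alpha> a), ract = (\<lambda>\<alpha> r a. \<alpha> a * r)\<rparr>"

text \<open>
  \<open>\<Delta> \<alpha>\<close> is the element of \<open>S \<otimes>\<^sub>R S\<close> that corresponds to \<open>a \<otimes> a' \<mapsto> \<alpha> (a a')\<close> under
  \<open>\<xi> \<otimes> \<eta> \<mapsto> (a \<otimes> a' \<mapsto> \<xi> a \<eta> a')\<close>. Lemma \<open>S_comult_quasibase\<close> below shows that it exists, is unique,
  and is given by the usual formula in terms of any left D2 quasibase.
\<close>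

definition S_comult :: "'a::{ring,monoid_mult} set \<Rightarrow> ('a \<Rightarrow> 'a) \<Rightarrow> (('a \<Rightarrow> 'a) \<times> ('a \<Rightarrow> 'a) \<Rightarrow>\<^sub>0 int) set" where
  "S_comult B \<alpha> = (THE X. X \<in> carr (tensor (S_bimodule B) (S_bimodule B)) \<and>
     (\<forall>a a'. tensor_lift (\<lambda>\<xi> \<eta>. \<xi> a * \<eta> a') X = \<alpha> (a * a')))"

definition S_coring :: "'a::{ring,monoid_mult} set \<Rightarrow> ('a, 'a \<Rightarrow> 'a) coring" where
  "S_coring B = bimodule.extend (S_bimodule B)
     \<lparr>comult = S_comult B, counit = (\<lambda>\<alpha>. \<alpha> 1)\<rparr>"

section \<open>The coproduct in terms of a quasibase\<close>

lemma int_scale_0 [simp]: "int_scale 0 x = 0"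
  by (simp add: int_scale_def)

lemma int_scale_1 [simp]: "int_scale 1 x = x"
  by (simp add: int_scale_def)

lemma int_scale_of_nat_diff:
  "int_scale (int a - int b) x = (\<Sum>i<a. x) - (\<Sum>i<b. x)"
proof -
  have s: "(\<Sum>i<j + k. x) = (\<Sum>i<j. x) + (\<Sum>i<k. x)" for j k :: nat
    by (induction k) (simp_all add: algebra_simps)
  show ?thesis
  proof (cases "b \<le> a")
    case True
    then obtain c where c: "a = b + c" using le_Suc_ex by blast
    have "int (b + c) - int b = int c" "nat (- int c) = 0" by simp_all
    then show ?thesis unfolding int_scale_def c using s[of b c] by (simp only:) simp
  next
    case False
    then obtain c where c: "b = a + c" using le_Suc_ex nat_le_linear by blast
    have "int a - int (a + c) = - int c" "nat (- int c) = 0" by simp_all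
    then show ?thesis unfolding int_scale_def c using s[of a c] by (simp only:) simp
  qed
qed

lemma int_scale_add: "int_scale (m + n) x = int_scale m x + int_scale n x"
proof -
  have s: "(\<Sum>i<j + k. x) = (\<Sum>i<j. x) + (\<Sum>i<k. x)" for j k :: nat
    by (induction k) (simp_all add: algebra_simps)
  obtain a b where m: "m = int a - int b" by (cases m rule: int_diff_cases) blast
  obtain c d where n: "n = int c - int d" by (cases n rule: int_diff_cases) blast
  have "m + n = int (a + c) - int (b + d)" by (simp add: m n)
  then show ?thesis
    by (simp only: m n int_scale_of_nat_diff s) (simp add: algebra_simps)
qed

lemma free_lift_superset:
  assumes "finite I" "Poly_Mapping.keys x \<subseteq> I"
  shows "free_lift f x = (\<Sum>b\<in>I. int_scale (Poly_Mapping.lookup x b) (f b))"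
  unfolding free_lift_def using assms
  by (intro sum.mono_neutral_left) (auto simp: in_keys_iff)

lemma free_lift_add: "free_lift f (x + y) = free_lift f x + free_lift f y"
proof -
  let ?I = "Poly_Mapping.keys x \<union> Poly_Mapping.keys y"
  have "Poly_Mapping.keys (x + y) \<subseteq> ?I" by (rule Poly_Mapping.keys_add)
  then show ?thesis
    by (simp add: free_lift_superset[of ?I] lookup_add int_scale_add sum.distrib)
qed

lemma free_lift_0 [simp]: "free_lift f 0 = 0"
  by (simp add: free_lift_def)

lemma free_lift_frag_of [simp]: "free_lift f (frag_of b) = f b"
  by (simp add: free_lift_def)

lemma free_lift_minus: "free_lift f (- x) = - free_lift f x"
  using free_lift_add[of f x "- x"] by (simp add: eq_neg_iff_add_eq_0 add.commute)

lemma free_lift_diff: "free_lift f (x - y) = free_lift f x - free_lift f y"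
  using free_lift_add[of f x "- y"] by (simp add: free_lift_minus)

lemma free_lift_sum: "free_lift f (\<Sum>i\<in>I. g i) = (\<Sum>i\<in>I. free_lift f (g i))"
  by (induction I rule: infinite_finite_induct) (simp_all add: free_lift_add)

lemma free_lift_frag_extend:
  "free_lift f (frag_extend (\<lambda>b. frag_of (g b)) x) = free_lift (f \<circ> g) x"
proof -
  have "Poly_Mapping.keys x \<subseteq> UNIV" by simp
  then show ?thesis
    by (induction x rule: frag_induction) (simp_all add: frag_extend_diff free_lift_diff)
qed

lemma free_lift_additive:
  assumes "\<And>u v. h (u + v) = h u + h v"
  shows "h (free_lift f x) = free_lift (\<lambda>b. h (f b)) x"
proof -
  have h0: "h 0 = 0" using assms[of 0 0] by simp
  have hd: "h (u - v) = h u - h v" for u v using assms[of "u - v" v] by simp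
  have "Poly_Mapping.keys x \<subseteq> UNIV" by simp
  then show ?thesis
    by (induction x rule: frag_induction) (simp_all add: h0 hd free_lift_diff)
qed

lemma free_lift_add_fun:
  "free_lift (\<lambda>b. f b + g b) x = free_lift f x + free_lift g x"
proof -
  have "Poly_Mapping.keys x \<subseteq> UNIV" by simp
  then show ?thesis
    by (induction x rule: frag_induction) (simp_all add: free_lift_diff)
qed

lemma free_lift_mult_right:
  fixes c :: "'a::{ring,monoid_mult}"
  shows "free_lift (\<lambda>(u, v). g u v * c) x = free_lift (\<lambda>(u, v). g u v) x * c"
  using free_lift_additive[of "\<lambda>z. z * c" "\<lambda>(u, v). g u v" x]
  by (simp add: distrib_right case_prod_unfold)

lemma free_lift_mult_left:
  fixes c :: "'a::{ring,monoid_mult}"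
  shows "free_lift (\<lambda>(u, v). c * g u v) x = c * free_lift (\<lambda>(u, v). g u v) x"
  using free_lift_additive[of "\<lambda>z. c * z" "\<lambda>(u, v). g u v" x]
  by (simp add: distrib_left case_prod_unfold)

definition balanced_map ::
  "('l, 'm::plus, 'r, 'x) bimodule_scheme \<Rightarrow> ('r, 'n::plus, 's, 'y) bimodule_scheme \<Rightarrow> ('m \<Rightarrow> 'n \<Rightarrow> 'k::ab_group_add) \<Rightarrow> bool" where
  "balanced_map M N f \<longleftrightarrow>
     (\<forall>m\<in>carr M. \<forall>m'\<in>carr M. \<forall>n\<in>carr N. f (m + m') n = f m n + f m' n) \<and>
     (\<forall>m\<in>carr M. \<forall>n\<in>carr N. \<forall>n'\<in>carr N. f m (n + n') = f m n + f m n') \<and>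
     (\<forall>m\<in>carr M. \<forall>r\<in>rring M. \<forall>n\<in>carr N. f (ract M m r) n = f m (lact N r n))"

lemma free_lift_tensor_rels:
  assumes "balanced_map M N f" "x \<in> tensor_rels M N"
  shows "free_lift (case_prod f) x = 0"
  using assms(2,1)
  by (induction rule: tensor_rels.induct) (auto simp: free_lift_diff balanced_map_def)

lemma tensor_lift_coset:
  assumes "balanced_map M N f"
  shows "tensor_lift f (x +o tensor_rels M N) = free_lift (case_prod f) x"
proof -
  have "free_lift (case_prod f) ` (x +o tensor_rels M N) = {free_lift (case_prod f) x}"
    using free_lift_tensor_rels[OF assms] tensor_rels.zero[of M N]
    by (force simp: elt_set_plus_def free_lift_add)
  then show ?thesis by (simp add: tensor_lift_def)
qed

lemma tensor_rels_minus: "x \<in> tensor_rels M N \<Longrightarrow> - x \<in> tensor_rels M N"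
  using tensor_rels.diff[OF tensor_rels.zero] by fastforce

lemma tensor_rels_add: "x \<in> tensor_rels M N \<Longrightarrow> y \<in> tensor_rels M N \<Longrightarrow> x + y \<in> tensor_rels M N"
  using tensor_rels.diff[of x M N "- y"] tensor_rels_minus by fastforce

lemma tensor_rels_sum:
  "(\<And>i. i \<in> I \<Longrightarrow> g i \<in> tensor_rels M N) \<Longrightarrow> (\<Sum>i\<in>I. g i) \<in> tensor_rels M N"
  by (induction I rule: infinite_finite_induct) (auto intro: tensor_rels.zero tensor_rels_add)

lemma coset_eq_iff:
  "x +o tensor_rels M N = y +o tensor_rels M N \<longleftrightarrow> x - y \<in> tensor_rels M N"
proof
  assume "x +o tensor_rels M N = y +o tensor_rels M N"
  moreover have "x \<in> x +o tensor_rels M N"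
    using tensor_rels.zero[of M N] by (force simp: elt_set_plus_def)
  ultimately show "x - y \<in> tensor_rels M N" by (auto simp: elt_set_plus_def)
next
  assume d: "x - y \<in> tensor_rels M N"
  have "\<exists>b\<in>tensor_rels M N. x + k = y + b" if "k \<in> tensor_rels M N" for k
    using tensor_rels_add[OF d that] by (intro bexI) (auto simp: algebra_simps)
  moreover have "\<exists>b\<in>tensor_rels M N. y + k = x + b" if "k \<in> tensor_rels M N" for k
    using tensor_rels.diff[OF that d] by (intro bexI) (auto simp: algebra_simps)
  ultimately show "x +o tensor_rels M N = y +o tensor_rels M N"
    by (auto simp: elt_set_plus_def)
qed

lemma coset_add_rels: "(x +o tensor_rels M N) + tensor_rels M N = x +o tensor_rels M N"
proof -
  have "tensor_rels M N + tensor_rels M N = tensor_rels M N"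
    using tensor_rels_add tensor_rels.zero[of M N]
    by (force simp: set_plus_def)
  then show ?thesis by (simp add: set_plus_rearrange3)
qed

lemma sum_cosets:
  "(\<Sum>i<(n::nat). x i +o tensor_rels M N) + tensor_rels M N = (\<Sum>i<n. x i) +o tensor_rels M N"
proof (induction n)
  case 0
  show ?case by (simp add: elt_set_plus_def)
next
  case (Suc n)
  have "(\<Sum>i<Suc n. x i +o tensor_rels M N) + tensor_rels M N =
      ((\<Sum>i<n. x i +o tensor_rels M N) + tensor_rels M N) + (x n +o tensor_rels M N)"
    by (simp add: ac_simps)
  also have "\<dots> = ((\<Sum>i<n. x i) + x n) +o (tensor_rels M N + tensor_rels M N)"
    by (simp only: Suc.IH set_plus_rearrange)
  also have "\<dots> = ((\<Sum>i<n. x i) + x n) +o tensor_rels M N"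
    by (metis coset_add_rels set_plus_rearrange3)
  finally show ?case by (simp add: add.commute)
qed

lemma image_coset:
  assumes "\<And>u v. \<phi> (u + v) = \<phi> u + \<phi> v"
    and "\<And>k. k \<in> tensor_rels M N \<Longrightarrow> \<phi> k \<in> tensor_rels M N"
  shows "\<phi> ` (x +o tensor_rels M N) + tensor_rels M N = \<phi> x +o tensor_rels M N"
proof -
  have z: "\<phi> 0 = 0" using assms(1)[of 0 0] by simp
  show ?thesis
  proof (intro equalityI subsetI)
    fix z assume "z \<in> \<phi> ` (x +o tensor_rels M N) + tensor_rels M N"
    then obtain k l where k: "k \<in> tensor_rels M N" "l \<in> tensor_rels M N" "z = \<phi> (x + k) + l"
      by (auto simp: set_plus_def elt_set_plus_def)
    then have "z = \<phi> x + (\<phi> k + l)" by (simp only: assms(1) add.assoc)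
    then show "z \<in> \<phi> x +o tensor_rels M N"
      using tensor_rels_add[OF assms(2)[OF k(1)] k(2)] by (simp add: set_plus_intro2)
  next
    fix z assume "z \<in> \<phi> x +o tensor_rels M N"
    then obtain l where l: "l \<in> tensor_rels M N" "z = \<phi> x + l"
      by (auto simp: elt_set_plus_def)
    have "x + 0 \<in> x +o tensor_rels M N" by (rule set_plus_intro2[OF tensor_rels.zero])
    then have "\<phi> x \<in> \<phi> ` (x +o tensor_rels M N)" by (simp only: add_0_right imageI)
    then show "z \<in> \<phi> ` (x +o tensor_rels M N) + tensor_rels M N"
      using l by (simp only: set_plus_intro)
  qed
qed

lemma mult_bimodule_simps [simp]:
  "lring (mult_bimodule L M R) = L" "carr (mult_bimodule L M R) = M"
  "rring (mult_bimodule L M R) = R"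
  "lact (mult_bimodule L M R) = (*)" "ract (mult_bimodule L M R) = (*)"
  by (simp_all add: mult_bimodule_def)

lemma AA_simps [simp]:
  "lring (AA L B R) = L" "rring (AA L B R) = R"
  by (simp_all add: AA_def tensor_def)

lemma tensor_rels_AA:
  "tensor_rels (mult_bimodule L UNIV B) (mult_bimodule B UNIV R) =
   tensor_rels (mult_bimodule L' UNIV B) (mult_bimodule B UNIV R')" (is "?K L R = ?K L' R'")
proof -
  have "x \<in> ?K L' R'" if "x \<in> ?K L R" for x L L' R R'
    using that
  proof (induction rule: tensor_rels.induct)
    case zero
    show ?case by (rule tensor_rels.zero)
  next
    case (diff x y)
    show ?case by (rule tensor_rels.diff[OF diff.IH])
  next
    case (add_left m m' n)
    show ?case by (rule tensor_rels.add_left) simp_all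
  next
    case (add_right m n n')
    show ?case by (rule tensor_rels.add_right) simp_all
  next
    case (balanced m r n)
    then show ?case
      using tensor_rels.balanced[of m "mult_bimodule L' UNIV B" r n "mult_bimodule B UNIV R'"]
      by simp
  qed
  then show ?thesis by (intro equalityI subsetI)
qed

abbreviation (input) KA :: "'a::{ring,monoid_mult} set \<Rightarrow> ('a \<times> 'a \<Rightarrow>\<^sub>0 int) set" where
  "KA B \<equiv> tensor_rels (mult_bimodule UNIV UNIV B) (mult_bimodule B UNIV UNIV)"

lemma carr_AA: "carr (AA L B R) = {x +o KA B |x. True}"
  unfolding AA_def tensor_def tensor_rels_AA[of L B R UNIV UNIV] by simp

lemma lact_AA: "lact (AA L B R) a (x +o KA B) = frag_extend (\<lambda>(m, n). frag_of (a * m, n)) x +o KA B"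
proof -
  let ?\<phi> = "frag_extend (\<lambda>(m, n). frag_of (a * m, n))"
  have "?\<phi> k \<in> KA B" if "k \<in> KA B" for k
    using that
  proof (induction rule: tensor_rels.induct)
    case (add_left m m' n)
    show ?case using tensor_rels.add_left[of "a * m" "mult_bimodule UNIV UNIV B" "a * m'" n "mult_bimodule B UNIV UNIV"]
      by (simp add: frag_extend_diff distrib_left)
  next
    case (add_right m n n')
    show ?case using tensor_rels.add_right[of "a * m" "mult_bimodule UNIV UNIV B" n "mult_bimodule B UNIV UNIV" n']
      by (simp add: frag_extend_diff)
  next
    case (balanced m r n)
    then show ?case using tensor_rels.balanced[of "a * m" "mult_bimodule UNIV UNIV B" r n "mult_bimodule B UNIV UNIV"]
      by (simp add: frag_extend_diff mult.assoc)
  qed (simp_all add: frag_extend_diff tensor_rels.zero tensor_rels.diff)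
  from image_coset[OF frag_extend_add this] show ?thesis
    unfolding AA_def tensor_def tensor_rels_AA[of L B R UNIV UNIV] by simp
qed

lemma ract_AA: "ract (AA L B R) (x +o KA B) a = frag_extend (\<lambda>(m, n). frag_of (m, n * a)) x +o KA B"
proof -
  let ?\<phi> = "frag_extend (\<lambda>(m, n). frag_of (m, n * a))"
  have "?\<phi> k \<in> KA B" if "k \<in> KA B" for k
    using that
  proof (induction rule: tensor_rels.induct)
    case (add_left m m' n)
    show ?case using tensor_rels.add_left[of m "mult_bimodule UNIV UNIV B" m' "n * a" "mult_bimodule B UNIV UNIV"]
      by (simp add: frag_extend_diff)
  next
    case (add_right m n n')
    show ?case using tensor_rels.add_right[of m "mult_bimodule UNIV UNIV B" "n * a" "mult_bimodule B UNIV UNIV" "n' * a"]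
      by (simp add: frag_extend_diff distrib_right)
  next
    case (balanced m r n)
    then show ?case using tensor_rels.balanced[of m "mult_bimodule UNIV UNIV B" r "n * a" "mult_bimodule B UNIV UNIV"]
      by (simp add: frag_extend_diff mult.assoc)
  qed (simp_all add: frag_extend_diff tensor_rels.zero tensor_rels.diff)
  from image_coset[OF frag_extend_add this] show ?thesis
    unfolding AA_def tensor_def tensor_rels_AA[of L B R UNIV UNIV] by simp
qed

lemma tensor_lift_AA:
  assumes "\<And>x x' y. f (x + x') y = f x y + f x' y" "\<And>x y y'. f x (y + y') = f x y + f x y'"
    and "\<And>x b y. b \<in> B \<Longrightarrow> f (x * b) y = f x (b * y)"
  shows "tensor_lift f (x +o KA B) = free_lift (case_prod f) x"
  by (rule tensor_lift_coset) (use assms in \<open>auto simp: balanced_map_def\<close>)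

lemma End_BAB_iff:
  "\<alpha> \<in> End_BAB B \<longleftrightarrow> (\<forall>x y. \<alpha> (x + y) = \<alpha> x + \<alpha> y) \<and>
     (\<forall>b\<in>B. \<forall>x. \<alpha> (b * x) = b * \<alpha> x) \<and> (\<forall>b\<in>B. \<forall>x. \<alpha> (x * b) = \<alpha> x * b)"
  by (auto simp: End_BAB_def bimodule_hom_def)

lemma tensor_lift_S:
  "tensor_lift (\<lambda>\<xi> \<eta>. \<xi> a * \<eta> a') (x +o tensor_rels (S_bimodule B) (S_bimodule B)) =
   free_lift (\<lambda>(\<xi>, \<eta>). \<xi> a * \<eta> a') x"
  by (rule tensor_lift_coset)
    (auto simp: balanced_map_def S_bimodule_def distrib_left distrib_right mult.assoc)

text \<open>
  The second assumption says that the elements \<open>t i\<close> lie in \<open>(A \<otimes>\<^sub>B A)\<^sup>B\<close>, the last one that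
  \<open>a \<otimes> a' = \<Sum>i<n. t i \<cdot> \<beta> i a a'\<close>. Adding \<open>tensor_rels\<close>, the zero of the quotient, only matters
  for \<open>n = 0\<close>.
\<close>

theorem S_comult_quasibase:
  fixes B :: "'a::{ring,monoid_mult} set" and n :: nat
  assumes t: "\<And>i. i < n \<Longrightarrow> t i \<in> carr (AA B B B)"
    and tB: "\<And>i b. i < n \<Longrightarrow> b \<in> B \<Longrightarrow> lact (AA B B B) b (t i) = ract (AA B B B) (t i) b"
    and \<beta>: "\<And>i. i < n \<Longrightarrow> \<beta> i \<in> End_BAB B"
    and qb: "\<And>a a'. pure_tensor (mult_bimodule UNIV UNIV B) (mult_bimodule B UNIV UNIV) a a' =
      (\<Sum>i<n. ract (AA B B UNIV) (t i) (\<beta> i a * a')) +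
      tensor_rels (mult_bimodule UNIV UNIV B) (mult_bimodule B UNIV UNIV)"
    and \<alpha>: "\<alpha> \<in> End_BAB B"
  defines "D \<equiv> (\<Sum>i<n. pure_tensor (S_bimodule B) (S_bimodule B)
      (\<lambda>a. tensor_lift (\<lambda>x y. \<alpha> (a * x) * y) (t i)) (\<beta> i)) + tensor_rels (S_bimodule B) (S_bimodule B)"
  shows "S_comult B \<alpha> = D"
    and "D \<in> carr (tensor (S_bimodule B) (S_bimodule B))"
    and "tensor_lift (\<lambda>\<xi> \<eta>. \<xi> a * \<eta> a') D = \<alpha> (a * a')"
    and "\<lbrakk>X \<in> carr (tensor (S_bimodule B) (S_bimodule B));
          \<And>a a'. tensor_lift (\<lambda>\<xi> \<eta>. \<xi> a * \<eta> a') X = \<alpha> (a * a')\<rbrakk> \<Longrightarrow> X = D"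
proof -
  let ?K = "tensor_rels (S_bimodule B) (S_bimodule B)"
  have "\<exists>p. \<forall>i<n. t i = p i +o KA B"
    using t unfolding carr_AA by (intro choice) blast
  then obtain p where p: "\<And>i. i < n \<Longrightarrow> t i = p i +o KA B" by blast
  have lift: "tensor_lift f (t i) = free_lift (case_prod f) (p i)"
    if "i < n" "\<And>x x' y. f (x + x') y = f x y + f x' y" "\<And>x y y'. f x (y + y') = f x y + f x y'"
      "\<And>x b y. b \<in> B \<Longrightarrow> f (x * b) y = f x (b * y)"
    for i and f :: "'a \<Rightarrow> 'a \<Rightarrow> 'a"
    using that by (simp add: p tensor_lift_AA)
  have liftB: "free_lift (\<lambda>(x, y). f (b * x) y) (p i) = free_lift (\<lambda>(x, y). f x (y * b)) (p i)"
    if "i < n" "b \<in> B" "\<And>x x' y. f (x + x') y = f x y + f x' y" "\<And>x y y'. f x (y + y') = f x y + f x y'"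
      "\<And>x b y. b \<in> B \<Longrightarrow> f (x * b) y = f x (b * y)"
    for i b and f :: "'a \<Rightarrow> 'a \<Rightarrow> 'a"
  proof -
    have g: "free_lift (case_prod f) (frag_extend (\<lambda>(m, n). frag_of (b * m, n)) x) =
        free_lift (\<lambda>(x, y). f (b * x) y) x" for x
      using free_lift_frag_extend[of "case_prod f" "\<lambda>(m, n). (b * m, n)" x]
      by (simp add: case_prod_unfold comp_def)
    have h: "free_lift (case_prod f) (frag_extend (\<lambda>(m, n). frag_of (m, n * b)) x) =
        free_lift (\<lambda>(x, y). f x (y * b)) x" for x
      using free_lift_frag_extend[of "case_prod f" "\<lambda>(m, n). (m, n * b)" x]
      by (simp add: case_prod_unfold comp_def)
    have "tensor_lift f (lact (AA B B B) b (t i)) = tensor_lift f (ract (AA B B B) (t i) b)"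
      using tB that by simp
    then show ?thesis
      using that by (simp add: p lact_AA ract_AA tensor_lift_AA g h)
  qed
  have qb': "free_lift (case_prod f) (frag_of (a, a')) =
      (\<Sum>i<n. free_lift (\<lambda>(x, y). f x (y * (\<beta> i a * a'))) (p i))"
    if "\<And>x x' y. f (x + x') y = f x y + f x' y" "\<And>x y y'. f x (y + y') = f x y + f x y'"
      "\<And>x b y. b \<in> B \<Longrightarrow> f (x * b) y = f x (b * y)"
    for f :: "'a \<Rightarrow> 'a \<Rightarrow> 'a" and a a'
  proof -
    let ?q = "\<lambda>i. frag_extend (\<lambda>(m, k). frag_of (m, k * (\<beta> i a * a'))) (p i)"
    have "frag_of (a, a') +o KA B = (\<Sum>i<n. ?q i +o KA B) + KA B"
      using qb[of a a'] by (simp add: pure_tensor_def p ract_AA)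
    also have "\<dots> = (\<Sum>i<n. ?q i) +o KA B" by (rule sum_cosets)
    finally have "tensor_lift f (frag_of (a, a') +o KA B) = tensor_lift f ((\<Sum>i<n. ?q i) +o KA B)"
      by simp
    then have "free_lift (case_prod f) (frag_of (a, a')) = free_lift (case_prod f) (\<Sum>i<n. ?q i)"
      using that by (simp only: tensor_lift_AA)
    also have "\<dots> = (\<Sum>i<n. free_lift (case_prod f) (?q i))" by (rule free_lift_sum)
    also have "\<dots> = (\<Sum>i<n. free_lift (\<lambda>(x, y). f x (y * (\<beta> i a * a'))) (p i))"
    proof (rule sum.cong[OF refl])
      fix i
      show "free_lift (case_prod f) (?q i) = free_lift (\<lambda>(x, y). f x (y * (\<beta> i a * a'))) (p i)"
        using free_lift_frag_extend[of "case_prod f" "\<lambda>(m, k). (m, k * (\<beta> i a * a'))" "p i"]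
        by (simp add: case_prod_unfold comp_def)
    qed
    finally show ?thesis .
  qed
  define \<rho> where "\<rho> \<zeta> i a = free_lift (\<lambda>(x, y). \<zeta> (a * x) * y) (p i)" for \<zeta> :: "'a \<Rightarrow> 'a" and i a
  have \<rho>: "(\<lambda>a. tensor_lift (\<lambda>x y. \<zeta> (a * x) * y) (t i)) = \<rho> \<zeta> i" if "i < n" "\<zeta> \<in> End_BAB B" for \<zeta> i
  proof
    fix a
    have "tensor_lift (\<lambda>x y. \<zeta> (a * x) * y) (t i) = free_lift (case_prod (\<lambda>x y. \<zeta> (a * x) * y)) (p i)"
      using that unfolding End_BAB_iff
      by (intro lift) (simp_all add: algebra_simps flip: mult.assoc)
    then show "tensor_lift (\<lambda>x y. \<zeta> (a * x) * y) (t i) = \<rho> \<zeta> i a" by (simp add: \<rho>_def)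
  qed
  have \<rho>_add: "\<rho> \<zeta> i (a + a') = \<rho> \<zeta> i a + \<rho> \<zeta> i a'" if "\<zeta> \<in> End_BAB B" for \<zeta> i a a'
  proof -
    have "(\<lambda>(x, y). \<zeta> ((a + a') * x) * y) = (\<lambda>b. (case b of (x, y) \<Rightarrow> \<zeta> (a * x) * y) + (case b of (x, y) \<Rightarrow> \<zeta> (a' * x) * y))"
      using that by (auto simp: End_BAB_iff algebra_simps)
    then show ?thesis by (simp only: \<rho>_def free_lift_add_fun)
  qed
  have \<rho>_S: "\<rho> \<zeta> i \<in> End_BAB B" if "\<zeta> \<in> End_BAB B" "i < n" for \<zeta> i
    unfolding End_BAB_iff
  proof (intro conjI allI ballI)
    fix b x assume b: "b \<in> B"
    show "\<rho> \<zeta> i (b * x) = b * \<rho> \<zeta> i x"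
      using that b free_lift_mult_left[of b "\<lambda>u v. \<zeta> (x * u) * v" "p i"]
      by (simp add: \<rho>_def End_BAB_iff mult.assoc)
    have "\<rho> \<zeta> i (x * b) = free_lift (\<lambda>(u, v). \<zeta> (x * u) * (v * b)) (p i)"
      using that b liftB[of i b "\<lambda>u v. \<zeta> (x * u) * v"] unfolding End_BAB_iff
      by (simp add: \<rho>_def algebra_simps) (simp add: algebra_simps flip: mult.assoc)
    also have "\<dots> = \<rho> \<zeta> i x * b"
      using free_lift_mult_right[of "\<lambda>u v. \<zeta> (x * u) * v" b "p i"]
      by (simp add: \<rho>_def mult.assoc)
    finally show "\<rho> \<zeta> i (x * b) = \<rho> \<zeta> i x * b" .
  qed (use that \<rho>_add in auto)
  have D: "D = (\<Sum>i<n. frag_of (\<rho> \<alpha> i, \<beta> i)) +o ?K"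
    unfolding D_def pure_tensor_def using \<alpha>
    by (subst sum_cosets[symmetric]) (simp add: \<rho>)
  have keys: "Poly_Mapping.keys (\<Sum>i<n. frag_of (\<rho> \<alpha> i, \<beta> i)) \<subseteq> End_BAB B \<times> End_BAB B"
    by (rule subset_trans[OF keys_sum]) (use \<rho>_S[OF \<alpha>] \<beta> in auto)
  show D_carr: "D \<in> carr (tensor (S_bimodule B) (S_bimodule B))"
    unfolding D tensor_def using keys by (auto simp: S_bimodule_def)
  have ev: "tensor_lift (\<lambda>\<xi> \<eta>. \<xi> a * \<eta> a') D = \<alpha> (a * a')" for a a'
  proof -
    have "\<alpha> (a * a') = free_lift (case_prod (\<lambda>x y. \<alpha> (a * x) * y)) (frag_of (a', 1))"
      by simp
    also have "\<dots> = (\<Sum>i<n. free_lift (\<lambda>(x, y). \<alpha> (a * x) * (y * (\<beta> i a' * 1))) (p i))"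
      using \<alpha> unfolding End_BAB_iff
      by (intro qb') (simp_all add: algebra_simps flip: mult.assoc)
    also have "\<dots> = (\<Sum>i<n. \<rho> \<alpha> i a * \<beta> i a')"
      by (simp add: \<rho>_def free_lift_mult_right flip: mult.assoc)
    finally show ?thesis
      by (simp add: D tensor_lift_S free_lift_sum)
  qed
  then show "tensor_lift (\<lambda>\<xi> \<eta>. \<xi> a * \<eta> a') D = \<alpha> (a * a')" .
  have R: "free_lift (\<lambda>(x, y). \<eta> x * y) (p i) \<in> centralizer B" if "i < n" "\<eta> \<in> End_BAB B" for i \<eta>
  proof -
    have "free_lift (\<lambda>(x, y). \<eta> x * y) (p i) * b = b * free_lift (\<lambda>(x, y). \<eta> x * y) (p i)" if "b \<in> B" for b
    proof -
      have "free_lift (\<lambda>(x, y). \<eta> x * y) (p i) * b = free_lift (\<lambda>(x, y). \<eta> x * (y * b)) (p i)"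
        by (simp add: free_lift_mult_right flip: mult.assoc)
      also have "\<dots> = free_lift (\<lambda>(x, y). \<eta> (b * x) * y) (p i)"
        using \<open>\<eta> \<in> End_BAB B\<close> \<open>i < n\<close> that unfolding End_BAB_iff
        by (intro liftB[symmetric]) (simp_all add: algebra_simps)
      also have "\<dots> = b * free_lift (\<lambda>(x, y). \<eta> x * y) (p i)"
        using \<open>\<eta> \<in> End_BAB B\<close> that
        by (simp add: End_BAB_iff mult.assoc free_lift_mult_left)
      finally show ?thesis .
    qed
    then show ?thesis by (simp add: centralizer_def)
  qed
  have S0: "0 \<in> End_BAB B" by (simp add: End_BAB_iff)
  have Sadd: "\<xi> + \<eta> \<in> End_BAB B" if "\<xi> \<in> End_BAB B" "\<eta> \<in> End_BAB B" for \<xi> \<eta>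
    using that by (simp add: End_BAB_iff algebra_simps)
  have Sdiff: "\<xi> - \<eta> \<in> End_BAB B" if "\<xi> \<in> End_BAB B" "\<eta> \<in> End_BAB B" for \<xi> \<eta>
    using that by (simp add: End_BAB_iff algebra_simps)
  have Sl: "(\<lambda>a. r * \<xi> a) \<in> End_BAB B" if "\<xi> \<in> End_BAB B" "r \<in> centralizer B" for \<xi> r
    using that by (simp add: End_BAB_iff centralizer_def distrib_left)
      (metis mult.assoc)
  have Sr: "(\<lambda>a. \<xi> a * r) \<in> End_BAB B" if "\<xi> \<in> End_BAB B" "r \<in> centralizer B" for \<xi> r
    using that by (simp add: End_BAB_iff centralizer_def distrib_right)
      (metis mult.assoc)
  have zero_left: "frag_of (0, \<eta>) \<in> ?K" if "\<eta> \<in> End_BAB B" for \<eta>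
    using tensor_rels.add_left[of 0 "S_bimodule B" 0 \<eta> "S_bimodule B"] that S0 tensor_rels_minus
    by (force simp: S_bimodule_def)
  have zero_right: "frag_of (\<eta>, 0) \<in> ?K" if "\<eta> \<in> End_BAB B" for \<eta>
    using tensor_rels.add_right[of \<eta> "S_bimodule B" 0 "S_bimodule B" 0] that S0 tensor_rels_minus
    by (force simp: S_bimodule_def)
  have diff_left: "frag_of (\<xi> - \<xi>', \<eta>) - (frag_of (\<xi>, \<eta>) - frag_of (\<xi>', \<eta>)) \<in> ?K"
    if "\<xi> \<in> End_BAB B" "\<xi>' \<in> End_BAB B" "\<eta> \<in> End_BAB B" for \<xi> \<xi>' \<eta>
    using tensor_rels_minus[OF tensor_rels.add_left[of "\<xi> - \<xi>'" "S_bimodule B" \<xi>' \<eta> "S_bimodule B"]] that Sdiff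
    by (simp add: S_bimodule_def algebra_simps)
  have sum_S: "(\<lambda>a. \<Sum>i<m. g i a) \<in> End_BAB B" if "\<And>i. i < m \<Longrightarrow> g i \<in> End_BAB B" for m :: nat and g
    using that
  proof (induction m)
    case 0
    then show ?case using S0 by (simp add: zero_fun_def)
  next
    case (Suc m)
    then show ?case using Sadd[of "\<lambda>a. \<Sum>i<m. g i a" "g m"] by (simp add: plus_fun_def)
  qed
  have sum_right: "(\<Sum>i<m. frag_of (\<xi>, g i)) - frag_of (\<xi>, \<lambda>a. \<Sum>i<m. g i a) \<in> ?K"
    if "\<xi> \<in> End_BAB B" "\<And>i. i < m \<Longrightarrow> g i \<in> End_BAB B" for m :: nat and g \<xi>
    using that(2)
  proof (induction m)
    case 0
    then show ?case using tensor_rels_minus[OF zero_right[OF that(1)]] by (simp add: zero_fun_def)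
  next
    case (Suc m)
    have "frag_of (\<xi>, \<lambda>a. \<Sum>i<Suc m. g i a) - frag_of (\<xi>, \<lambda>a. \<Sum>i<m. g i a) - frag_of (\<xi>, g m) \<in> ?K"
      using tensor_rels.add_right[of \<xi> "S_bimodule B" "\<lambda>a. \<Sum>i<m. g i a" "S_bimodule B" "g m"]
        sum_S[of m g] Suc.prems that(1)
      by (simp add: S_bimodule_def plus_fun_def)
    from tensor_rels.diff[OF Suc.IH this] show ?case
      using Suc.prems by (simp add: algebra_simps)
  qed
  define G where "G x i = (\<lambda>a. free_lift (\<lambda>(u, v). free_lift (\<lambda>(\<xi>, \<eta>). \<xi> a * \<eta> u) x * v) (p i))"
    for x :: "('a \<Rightarrow> 'a) \<times> ('a \<Rightarrow> 'a) \<Rightarrow>\<^sub>0 int" and i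
  have G_frag: "G (frag_of (\<xi>, \<eta>)) i = (\<lambda>a. \<xi> a * free_lift (\<lambda>(u, v). \<eta> u * v) (p i))" for \<xi> \<eta> i
    by (simp add: G_def mult.assoc free_lift_mult_left)
  have G_0: "G 0 i = 0" for i
    using free_lift_additive[of "\<lambda>_. 0" "\<lambda>_. 0" "p i"]
    by (simp add: G_def fun_eq_iff case_prod_unfold)
  have G_diff: "G (x - y) i = G x i - G y i" for x y i
  proof
    fix a
    let ?F = "\<lambda>x (u, v). free_lift (\<lambda>(\<xi>, \<eta>). \<xi> a * \<eta> u) (x :: ('a \<Rightarrow> 'a) \<times> ('a \<Rightarrow> 'a) \<Rightarrow>\<^sub>0 int) * v"
    have "?F x = (\<lambda>b. ?F (x - y) b + ?F y b)"
      by (auto simp: free_lift_diff algebra_simps)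
    then have "free_lift (?F x) (p i) = free_lift (\<lambda>b. ?F (x - y) b + ?F y b) (p i)"
      by (rule arg_cong[where f = "\<lambda>F. free_lift F (p i)"])
    also have "\<dots> = free_lift (?F (x - y)) (p i) + free_lift (?F y) (p i)"
      by (rule free_lift_add_fun)
    finally have "free_lift (?F x) (p i) = free_lift (?F (x - y)) (p i) + free_lift (?F y) (p i)" .
    then show "G (x - y) i a = (G x i - G y i) a" by (simp add: G_def)
  qed
  have main: "(\<forall>i<n. G x i \<in> End_BAB B) \<and> (\<Sum>i<n. frag_of (G x i, \<beta> i)) - x \<in> ?K"
    if "Poly_Mapping.keys x \<subseteq> End_BAB B \<times> End_BAB B" for x
    using that
  proof (induction x rule: frag_induction)
    case zero
    have "(\<Sum>i<n. frag_of (0, \<beta> i)) \<in> ?K"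
      using zero_left \<beta> by (intro tensor_rels_sum) auto
    then show ?case by (simp only: G_0 S0 diff_0_right simp_thms)
  next
    case (one z)
    then obtain \<xi> \<eta> where z: "z = (\<xi>, \<eta>)" "\<xi> \<in> End_BAB B" "\<eta> \<in> End_BAB B" by auto
    let ?r = "\<lambda>i. free_lift (\<lambda>(u, v). \<eta> u * v) (p i)"
    have a: "(\<Sum>i<n. ?r i * \<beta> i a) = \<eta> a" for a
    proof -
      have "\<eta> a = free_lift (case_prod (\<lambda>x y. \<eta> x * y)) (frag_of (a, 1))" by simp
      also have "\<dots> = (\<Sum>i<n. free_lift (\<lambda>(x, y). \<eta> x * (y * (\<beta> i a * 1))) (p i))"
        using z(3) unfolding End_BAB_iff by (intro qb') (simp_all add: algebra_simps)
      also have "\<dots> = (\<Sum>i<n. ?r i * \<beta> i a)"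
        by (simp add: free_lift_mult_right flip: mult.assoc)
      finally show ?thesis by simp
    qed
    have 1: "(\<Sum>i<n. frag_of (G (frag_of z) i, \<beta> i) - frag_of (\<xi>, \<lambda>a. ?r i * \<beta> i a)) \<in> ?K"
    proof (rule tensor_rels_sum)
      fix i assume "i \<in> {..<n}"
      then show "frag_of (G (frag_of z) i, \<beta> i) - frag_of (\<xi>, \<lambda>a. ?r i * \<beta> i a) \<in> ?K"
        using tensor_rels.balanced[of \<xi> "S_bimodule B" "?r i" "\<beta> i" "S_bimodule B"] z \<beta> R
        by (simp add: G_frag S_bimodule_def)
    qed
    have "(\<Sum>i<n. frag_of (\<xi>, \<lambda>a. ?r i * \<beta> i a)) - frag_of (\<xi>, \<lambda>a. \<Sum>i<n. ?r i * \<beta> i a) \<in> ?K"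
      using z \<beta> R Sl by (intro sum_right) auto
    from tensor_rels_add[OF 1 this] show ?case
      using z R Sr by (simp add: a sum_subtractf G_frag)
  next
    case (diff x y)
    have 1: "(\<Sum>i<n. frag_of (G x i - G y i, \<beta> i) - (frag_of (G x i, \<beta> i) - frag_of (G y i, \<beta> i))) \<in> ?K"
    proof (rule tensor_rels_sum)
      fix i assume "i \<in> {..<n}"
      then show "frag_of (G x i - G y i, \<beta> i) - (frag_of (G x i, \<beta> i) - frag_of (G y i, \<beta> i)) \<in> ?K"
        using diff \<beta> by (intro diff_left) auto
    qed
    have 2: "((\<Sum>i<n. frag_of (G x i, \<beta> i)) - x) - ((\<Sum>i<n. frag_of (G y i, \<beta> i)) - y) \<in> ?K"
      using diff by (simp add: tensor_rels.diff)
    have "(\<Sum>i<n. frag_of (G (x - y) i, \<beta> i)) - (x - y) \<in> ?K"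
      using tensor_rels_add[OF 1 2] by (simp add: G_diff sum_subtractf sum.distrib algebra_simps)
    moreover have "G (x - y) i \<in> End_BAB B" if "i < n" for i
      unfolding G_diff using diff that by (intro Sdiff) auto
    ultimately show ?case by blast
  qed
  show uniq: "X = D" if X: "X \<in> carr (tensor (S_bimodule B) (S_bimodule B))"
    "\<And>a a'. tensor_lift (\<lambda>\<xi> \<eta>. \<xi> a * \<eta> a') X = \<alpha> (a * a')" for X
  proof -
    obtain x where x: "X = x +o ?K" "Poly_Mapping.keys x \<subseteq> End_BAB B \<times> End_BAB B"
      using X(1) by (auto simp: tensor_def S_bimodule_def)
    have "G x i = \<rho> \<alpha> i" for i
      using X(2) by (simp add: x tensor_lift_S G_def \<rho>_def fun_eq_iff)
    then have "(\<Sum>i<n. frag_of (\<rho> \<alpha> i, \<beta> i)) - x \<in> ?K" using main[OF x(2)] by simp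
    then have "D = X" unfolding D x(1) coset_eq_iff .
    then show ?thesis by simp
  qed
  show "S_comult B \<alpha> = D"
    unfolding S_comult_def
  proof (rule the_equality)
    show "D \<in> carr (tensor (S_bimodule B) (S_bimodule B)) \<and>
        (\<forall>a a'. tensor_lift (\<lambda>\<xi> \<eta>. \<xi> a * \<eta> a') D = \<alpha> (a * a'))"
      using D_carr ev by simp
  qed (rule uniq; simp)
qed

end

theory Submission
  imports Defs
begin

text \<open>
  A separability element \<open>e = e\<^sup>1 \<otimes> e\<^sup>2\<close> gives the cointegral \<open>\<gamma>(\<alpha> \<otimes> \<beta>) = \<alpha>(e\<^sup>1) \<beta>(e\<^sup>2)\<close>. Conversely, let
  \<open>t\<^sub>i\<close>, \<open>\<beta>\<^sub>i\<close> be a left D2 quasibase, let \<open>\<gamma>\<close> be a cointegral and put \<open>e = \<Sum> t\<^sub>i \<gamma>(\<beta>\<^sub>i \<otimes> id)\<close>. Since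
  \<open>\<Delta> id = id \<otimes> id\<close>, the coseparability condition for \<open>c' = id\<close> reads
  \<open>c(a e\<^sup>1) e\<^sup>2 = \<gamma>(c \<otimes> id) a = c(e\<^sup>1) e\<^sup>2 a\<close> for all \<open>c \<in> S\<close>; in particular \<open>e\<^sup>1 e\<^sup>2 = \<gamma>(id \<otimes> id) = 1\<close>. The
  quasibase writes every right \<open>B\<close>-linear \<open>f : A \<rightarrow> A\<close> as \<open>\<Sum> f(t\<^sub>i\<^sup>1) t\<^sub>i\<^sup>2 \<beta>\<^sub>i\<close>, so the identity
  \<open>f(a e\<^sup>1) e\<^sup>2 = f(e\<^sup>1) e\<^sup>2 a\<close> extends to all such \<open>f\<close>. Applied to a dual basis of \<open>A\<^sub>B\<close> it yields \<open>a e = e a\<close>.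
\<close>

section \<open>Free abelian groups and tensor products\<close>

lemma sum_fun_apply: "(\<Sum>i\<in>I. g i) x = (\<Sum>i\<in>I. g i x)"
  by (induction I rule: infinite_finite_induct) simp_all

lemma free_lift_fun_apply: "free_lift F x a = free_lift (\<lambda>b. F b a) x"
  by (rule free_lift_additive[of "\<lambda>g. g a"]) simp

text \<open>Both sides are the same finite double sum. It serves to exchange the sum over a
  separability element with the sum over a coproduct.\<close>

lemma free_lift_swap:
  "free_lift (\<lambda>b. free_lift (\<lambda>d. F b d) y) x = free_lift (\<lambda>d. free_lift (\<lambda>b. F b d) x) y"
proof -
  have "Poly_Mapping.keys x \<subseteq> UNIV" by simp
  then show ?thesis
  proof (induction x rule: frag_induction)
    case zero
    show ?case using free_lift_additive[of "\<lambda>_. 0" "\<lambda>_. 0" y] by simp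
  next
    case (diff x x')
    have "free_lift (\<lambda>d. free_lift (\<lambda>b. F b d) x) y =
        free_lift (\<lambda>d. free_lift (\<lambda>b. F b d) (x - x') + free_lift (\<lambda>b. F b d) x') y"
      by (simp add: free_lift_diff)
    also have "\<dots> = free_lift (\<lambda>d. free_lift (\<lambda>b. F b d) (x - x')) y +
        free_lift (\<lambda>d. free_lift (\<lambda>b. F b d) x') y"
      by (rule free_lift_add_fun)
    finally show ?case using diff.IH by (simp only: free_lift_diff) simp
  qed simp
qed

lemma free_lift_sum_fun:
  "free_lift (\<lambda>b. \<Sum>i\<in>I. f i b) x = (\<Sum>i\<in>I. free_lift (f i) x)"
proof -
  have "Poly_Mapping.keys x \<subseteq> UNIV" by simp
  then show ?thesis
    by (induction x rule: frag_induction) (simp_all add: free_lift_diff sum_subtractf)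
qed

text \<open>\<open>tensor_rels M N\<close> is a subgroup and so absorbs itself under set addition;
  set addition of cosets is therefore the addition of the quotient group.\<close>

lemma coset_plus:
  "(x +o tensor_rels M N) + (y +o tensor_rels M N) = (x + y) +o tensor_rels M N"
  unfolding set_plus_rearrange
  using coset_add_rels[of "x + y" M N] by (simp only: set_plus_rearrange3)

lemma tensor_scalars [simp]: "lring (tensor M N) = lring M" "rring (tensor M N) = rring N"
  by (simp_all add: tensor_def)

lemma pure_tensor_add_left:
  assumes "m \<in> carr M" "m' \<in> carr M" "n \<in> carr N"
  shows "pure_tensor M N (m + m') n = pure_tensor M N m n + pure_tensor M N m' n"
  using tensor_rels.add_left[OF assms]
  by (simp add: pure_tensor_def coset_plus coset_eq_iff diff_diff_eq)

lemma pure_tensor_add_right: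
  assumes "m \<in> carr M" "n \<in> carr N" "n' \<in> carr N"
  shows "pure_tensor M N m (n + n') = pure_tensor M N m n + pure_tensor M N m n'"
  using tensor_rels.add_right[OF assms]
  by (simp add: pure_tensor_def coset_plus coset_eq_iff diff_diff_eq)

lemma pure_tensor_in_carr:
  "m \<in> carr M \<Longrightarrow> n \<in> carr N \<Longrightarrow> pure_tensor M N m n \<in> carr (tensor M N)"
  unfolding pure_tensor_def tensor_def by (auto intro!: exI[of _ "frag_of (m, n)"])

lemma tensor_lift_pure_tensor:
  "balanced_map M N f \<Longrightarrow> tensor_lift f (pure_tensor M N m n) = f m n"
  by (simp add: pure_tensor_def tensor_lift_coset)

text \<open>The assumptions say that acting by \<open>l\<close> maps each kind of defining relation
  to one of the same kind, so the action descends from representatives to cosets. They are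
  restricted to \<open>carr M\<close> because the axioms may fail outside it.\<close>

lemma lact_tensor_coset:
  assumes "\<And>m. m \<in> carr M \<Longrightarrow> lact M l m \<in> carr M"
    and "\<And>m m'. m \<in> carr M \<Longrightarrow> m' \<in> carr M \<Longrightarrow> lact M l (m + m') = lact M l m + lact M l m'"
    and "\<And>m r. m \<in> carr M \<Longrightarrow> r \<in> rring M \<Longrightarrow> lact M l (ract M m r) = ract M (lact M l m) r"
  shows "lact (tensor M N) l (x +o tensor_rels M N) =
    frag_extend (\<lambda>(m, n). frag_of (lact M l m, n)) x +o tensor_rels M N"
proof -
  have "frag_extend (\<lambda>(m, n). frag_of (lact M l m, n)) k \<in> tensor_rels M N"
    if "k \<in> tensor_rels M N" for k
    using that
  proof (induction rule: tensor_rels.induct)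
    case zero
    show ?case by (simp add: tensor_rels.zero)
  next
    case (diff x y)
    show ?case unfolding frag_extend_diff by (rule tensor_rels.diff[OF diff.IH])
  next
    case (add_left m m' n)
    then show ?case by (simp add: frag_extend_diff assms tensor_rels.add_left)
  next
    case (add_right m n n')
    then show ?case by (simp add: frag_extend_diff assms tensor_rels.add_right)
  next
    case (balanced m r n)
    then show ?case by (simp add: frag_extend_diff assms tensor_rels.balanced)
  qed
  from image_coset[OF frag_extend_add this] show ?thesis by (simp add: tensor_def)
qed

lemma ract_tensor_coset:
  assumes "\<And>n. n \<in> carr N \<Longrightarrow> ract N n s \<in> carr N"
    and "\<And>n n'. n \<in> carr N \<Longrightarrow> n' \<in> carr N \<Longrightarrow> ract N (n + n') s = ract N n s + ract N n' s"
    and "\<And>n r. n \<in> carr N \<Longrightarrow> r \<in> rring M \<Longrightarrow> ract N (lact N r n) s = lact N r (ract N n s)"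
  shows "ract (tensor M N) (x +o tensor_rels M N) s =
    frag_extend (\<lambda>(m, n). frag_of (m, ract N n s)) x +o tensor_rels M N"
proof -
  have "frag_extend (\<lambda>(m, n). frag_of (m, ract N n s)) k \<in> tensor_rels M N"
    if "k \<in> tensor_rels M N" for k
    using that
  proof (induction rule: tensor_rels.induct)
    case zero
    show ?case by (simp add: tensor_rels.zero)
  next
    case (diff x y)
    show ?case unfolding frag_extend_diff by (rule tensor_rels.diff[OF diff.IH])
  next
    case (add_left m m' n)
    then show ?case by (simp add: frag_extend_diff assms tensor_rels.add_left)
  next
    case (add_right m n n')
    then show ?case by (simp add: frag_extend_diff assms tensor_rels.add_right)
  next
    case (balanced m r n)
    then show ?case by (simp add: frag_extend_diff assms tensor_rels.balanced)
  qed
  from image_coset[OF frag_extend_add this] show ?thesis by (simp add: tensor_def)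
qed

text \<open>A coring and its underlying bimodule are records of different types and cannot be
  equated. Monotonicity in both directions shows that they have the same relations.\<close>

lemma tensor_rels_mono:
  assumes "x \<in> tensor_rels M N"
    and "carr M \<subseteq> carr M'" "rring M \<subseteq> rring M'" "ract M = ract M'"
    and "carr N \<subseteq> carr N'" "lact N = lact N'"
  shows "x \<in> tensor_rels M' N'"
  using assms(1)
proof (induction rule: tensor_rels.induct)
  case zero
  show ?case by (rule tensor_rels.zero)
next
  case (diff x y)
  show ?case by (rule tensor_rels.diff[OF diff.IH])
next
  case (add_left m m' n)
  then show ?case using assms by (intro tensor_rels.add_left) auto
next
  case (add_right m n n')
  then show ?case using assms by (intro tensor_rels.add_right) auto
next
  case (balanced m r n)
  then have "m \<in> carr M'" "r \<in> rring M'" "n \<in> carr N'" using assms by auto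
  then show ?case using assms(4,6) by (simp add: tensor_rels.balanced)
qed


section \<open>Direct summands of free modules\<close>

lemma subbimodule_add: "subbimodule P M \<Longrightarrow> x \<in> P \<Longrightarrow> y \<in> P \<Longrightarrow> x + y \<in> P"
  unfolding subbimodule_def by (metis diff_0 diff_minus_eq_add)

lemma subbimodule_sum:
  assumes "subbimodule P M" "\<And>i. i \<in> I \<Longrightarrow> g i \<in> P"
  shows "(\<Sum>i\<in>I. g i) \<in> P"
proof -
  have "0 \<in> P" using assms(1) by (simp add: subbimodule_def)
  then show ?thesis using assms(2)
    by (induction I rule: infinite_finite_induct) (simp_all add: subbimodule_add[OF assms(1)])
qed

lemma copies_mult_bimodule_simps [simp]:
  "lring (copies n (mult_bimodule L C R)) = L"
  "rring (copies n (mult_bimodule L C R)) = R"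
  "carr (copies n (mult_bimodule L C R)) = {v. (\<forall>i<n. v i \<in> C) \<and> (\<forall>i\<ge>n. v i = 0)}"
  "lact (copies n (mult_bimodule L C R)) l v = (\<lambda>i. if i < n then l * v i else 0)"
  "ract (copies n (mult_bimodule L C R)) v r = (\<lambda>i. if i < n then v i * r else 0)"
  by (auto simp: copies_def)

text \<open>
  The vectors \<open>f (x i)\<close> are the components of the standard basis of \<open>C\<^sup>n\<close> in the summand. No projection
  is needed: two expressions in \<open>P\<close> and \<open>Q\<close> that agree are both \<open>0\<close>.
\<close>

lemma direct_summand_frame:
  assumes iso: "iso_to_direct_summand M (copies n (mult_bimodule L C C))"
    and C: "0 \<in> C" "1 \<in> C" "L \<subseteq> C"
  obtains f x where
    "f \<in> bimodule_hom M (copies n (mult_bimodule L C C))" "inj_on f (carr M)"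
    "\<And>i. i < n \<Longrightarrow> x i \<in> carr M"
    "\<And>X j. X \<in> carr M \<Longrightarrow> j < n \<Longrightarrow> f X j = (\<Sum>i<n. f (x i) j * f X i)"
    "\<And>i j l. i < n \<Longrightarrow> j < n \<Longrightarrow> l \<in> L \<Longrightarrow> l * f (x i) j = f (x i) j * l"
proof -
  define N where "N = copies n (mult_bimodule L C C)"
  obtain P Q f where PQ: "subbimodule P N" "subbimodule Q N" "P \<inter> Q = {0}" "P + Q = carr N"
    and f: "f \<in> bimodule_hom M (N\<lparr>carr := P\<rparr>)" "bij_betw f (carr M) P"
    using iso by (auto simp: iso_to_direct_summand_def bimodule_iso_def N_def)
  have "\<exists>u w. u \<in> P \<and> w \<in> Q \<and> (\<lambda>j. if j = i then 1 else 0) = u + w" if "i < n" for i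
  proof -
    have "(\<lambda>j. if j = i then 1 else 0) \<in> P + Q"
      using that C unfolding PQ(4) by (auto simp: N_def)
    then show ?thesis by (auto simp: set_plus_def)
  qed
  then obtain u w where uw: "\<And>i. i < n \<Longrightarrow> u i \<in> P" "\<And>i. i < n \<Longrightarrow> w i \<in> Q"
    "\<And>i. i < n \<Longrightarrow> (\<lambda>j. if j = i then 1 else 0) = u i + w i"
    by metis
  have uw_apply: "u i j + w i j = (if j = i then 1 else 0)" if "i < n" for i j
    using fun_cong[OF uw(3)[OF that], of j] by simp
  have P_carr: "v j \<in> C" "v i = 0" if "v \<in> P" "j < n" "n \<le> i" for v i j
    using that PQ(1) by (auto simp: subbimodule_def N_def)
  have expand: "v j = (\<Sum>i<n. u i j * v i)" if v: "v \<in> P" and j: "j < n" for v j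
  proof -
    \<comment> \<open>Both facts of \<open>P_carr\<close> carry all three premises, so the one about
      indices beyond \<open>n\<close> also asks for some index below \<open>n\<close>; 0 serves as
      that index.\<close>
    have "0 < n" using j by simp
    \<comment> \<open>The vector \<open>v\<close> is the combination of the standard basis vectors
      \<open>u i + w i\<close> with coefficients \<open>v i\<close>. The equation separates the
      \<open>P\<close>-part from the \<open>Q\<close>-part.\<close>
    have e: "v - (\<Sum>i<n. ract N (u i) (v i)) = (\<Sum>i<n. ract N (w i) (v i))"
    proof
      fix j
      have "(\<Sum>i<n. u i j * v i) + (\<Sum>i<n. w i j * v i) = v j" if "j < n"
      proof -
        have "(\<Sum>i<n. u i j * v i) + (\<Sum>i<n. w i j * v i) = (\<Sum>i<n. (u i j + w i j) * v i)"
          by (simp add: sum.distrib distrib_right)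
        also have "\<dots> = (\<Sum>i<n. if j = i then v i else 0)"
          by (intro sum.cong) (auto simp: uw_apply)
        finally show ?thesis using that by simp
      qed
      then show "(v - (\<Sum>i<n. ract N (u i) (v i))) j = (\<Sum>i<n. ract N (w i) (v i)) j"
        using P_carr(2)[OF v \<open>0 < n\<close>, of j]
        by (cases "j < n") (simp_all add: N_def sum_fun_apply algebra_simps)
    qed
    have rP: "(\<Sum>i<n. ract N (u i) (v i)) \<in> P"
      using PQ(1) uw(1) P_carr(1)[OF v _ le_refl]
      by (intro subbimodule_sum[OF PQ(1)]) (auto simp: subbimodule_def N_def)
    have "(\<Sum>i<n. ract N (w i) (v i)) \<in> Q"
      using PQ(2) uw(2) P_carr(1)[OF v _ le_refl]
      by (intro subbimodule_sum[OF PQ(2)]) (auto simp: subbimodule_def N_def)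
    moreover have "v - (\<Sum>i<n. ract N (u i) (v i)) \<in> P"
      using PQ(1) v rP by (simp add: subbimodule_def)
    ultimately have "v - (\<Sum>i<n. ract N (u i) (v i)) = 0"
      unfolding e using PQ(3) by blast
    then have "v j = (\<Sum>i<n. ract N (u i) (v i)) j" by simp
    then show ?thesis using j by (simp add: sum_fun_apply N_def)
  qed
  have comm: "l * u i j = u i j * l" if "i < n" "j < n" "l \<in> L" for i j l
  proof -
    \<comment> \<open>Standard basis vectors have coordinates 0 and 1 and commute with
      \<open>l\<close>, so the commutators of \<open>l\<close> with \<open>u i\<close> and with
      \<open>w i\<close> are opposite.\<close>
    have e: "lact N l (u i) - ract N (u i) l = ract N (w i) l - lact N l (w i)"
    proof
      fix j
      have "l * (u i j + w i j) = (u i j + w i j) * l"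
        using that by (simp add: uw_apply)
      then show "(lact N l (u i) - ract N (u i) l) j = (ract N (w i) l - lact N l (w i)) j"
        by (simp add: N_def algebra_simps)
    qed
    have "lact N l (u i) - ract N (u i) l \<in> P"
      using PQ(1) uw(1) that C by (auto simp: subbimodule_def N_def)
    moreover have "ract N (w i) l - lact N l (w i) \<in> Q"
      using PQ(2) uw(2) that C by (auto simp: subbimodule_def N_def)
    ultimately have "lact N l (u i) - ract N (u i) l = 0"
      unfolding e using PQ(3) by blast
    then have "lact N l (u i) j = ract N (u i) l j" by simp
    then show ?thesis using that by (simp add: N_def)
  qed
  define x where "x i = inv_into (carr M) f (u i)" for i
  have x: "x i \<in> carr M" "f (x i) = u i" if "i < n" for i
    using uw(1)[OF that] f(2) unfolding x_def bij_betw_def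
    by (auto intro: inv_into_into f_inv_into_f)
  have fP: "f X \<in> P" if "X \<in> carr M" for X
    using f(2) that by (auto simp: bij_betw_def)
  show thesis
  proof
    show "f \<in> bimodule_hom M (copies n (mult_bimodule L C C))"
      using f(1) PQ(1) unfolding bimodule_hom_def N_def[symmetric]
      by (auto simp: subbimodule_def)
    show "inj_on f (carr M)" using f(2) by (simp add: bij_betw_def)
    show "f X j = (\<Sum>i<n. f (x i) j * f X i)" if "X \<in> carr M" "j < n" for X j
      using expand[OF fP[OF that(1)] that(2)] by (simp add: x)
    show "l * f (x i) j = f (x i) j * l" if "i < n" "j < n" "l \<in> L" for i j l
      using comm[OF that] x(2)[OF that(1)] by simp
  qed (rule x(1))
qed

section \<open>Dual bases and depth two quasibases\<close>

text \<open>The functional \<phi> k is the k-th coordinate of an embedding of A into copies of B,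
  and \<open>x k\<close> is the element whose image is the component of the k-th standard basis
  vector in the summand. Injectivity of the embedding turns the coordinate expansion into one in
  A.\<close>

lemma right_fg_projective_dual_basis:
  assumes "unital_subring B" "right_fg_projective B"
  obtains n :: nat and x \<phi> where
    "\<And>k a. k < n \<Longrightarrow> \<phi> k a \<in> B"
    "\<And>k a a'. k < n \<Longrightarrow> \<phi> k (a + a') = \<phi> k a + \<phi> k a'"
    "\<And>k a b. k < n \<Longrightarrow> b \<in> B \<Longrightarrow> \<phi> k (a * b) = \<phi> k a * b"
    "\<And>a. (\<Sum>k<n. x k * \<phi> k a) = a"
proof -
  have B: "0 \<in> B" "1 \<in> B"
    using assms(1) unfolding unital_subring_def by (metis diff_self)+
  let ?M = "mult_bimodule {} UNIV B"
  obtain n where iso: "iso_to_direct_summand ?M (copies n (mult_bimodule {} B B))"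
    using assms(2) by (auto simp: right_fg_projective_def)
  obtain f x where f: "f \<in> bimodule_hom ?M (copies n (mult_bimodule {} B B))"
    and inj: "inj_on f (carr ?M)"
    and exp: "\<And>X j. X \<in> carr ?M \<Longrightarrow> j < n \<Longrightarrow> f X j = (\<Sum>i<n. f (x i) j * f X i)"
    by (rule direct_summand_frame[OF iso B empty_subsetI]) blast
  have hom: "f X j \<in> B" "f (X + Y) j = f X j + f Y j" "b \<in> B \<Longrightarrow> f (X * b) j = f X j * b"
    if "j < n" for X Y b j
    using f that by (auto simp: bimodule_hom_def)
  have zero: "f X j = 0" if "n \<le> j" for X j
    using f that by (auto simp: bimodule_hom_def)
  have f_sum: "f (\<Sum>i<(m::nat). g i) j = (\<Sum>i<m. f (g i) j)" if "j < n" for g m j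
  proof -
    have "f 0 j = 0" using hom(2)[OF that, of 0 0] by simp
    then show ?thesis by (induction m) (simp_all add: hom(2)[OF that])
  qed
  have "(\<Sum>i<n. x i * f X i) = X" for X
  proof (rule inj_onD[OF inj], rule ext)
    fix j
    show "f (\<Sum>i<n. x i * f X i) j = f X j"
    proof (cases "j < n")
      case True
      have "f (\<Sum>i<n. x i * f X i) j = (\<Sum>i<n. f (x i) j * f X i)"
        by (simp add: f_sum hom True)
      also have "\<dots> = f X j" by (rule exp[symmetric]) (simp_all add: True)
      finally show ?thesis .
    qed (simp add: zero)
  qed simp_all
  then show thesis using that[of n "\<lambda>k a. f a k" x] hom by blast
qed

text \<open>An embedding of A \<otimes> A over B into copies of A, as B-A-bimodules, gives a frame:
  its vectors are the tensors of the quasibase, and \<beta> i a is the i-th coordinate of a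
  \<otimes> 1. Expanding a \<otimes> 1 in the frame and acting by a' on the right gives the last
  property.\<close>

lemma depth_two_quasibase:
  assumes "depth_two B"
  obtains n :: nat and p \<beta> where
    "\<And>i. i < n \<Longrightarrow> \<beta> i \<in> End_BAB B"
    "\<And>i b. i < n \<Longrightarrow> b \<in> B \<Longrightarrow>
      lact (AA B B B) b (p i +o KA B) = ract (AA B B B) (p i +o KA B) b"
    "\<And>a a'. pure_tensor (mult_bimodule UNIV UNIV B) (mult_bimodule B UNIV UNIV) a a' =
      (\<Sum>i<n. ract (AA B B UNIV) (p i +o KA B) (\<beta> i a * a')) + KA B"
proof -
  let ?M = "AA B B UNIV"
  obtain n where iso: "iso_to_direct_summand ?M (copies n (mult_bimodule B UNIV UNIV))"
    using assms by (auto simp: depth_two_def)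
  obtain f x where f: "f \<in> bimodule_hom ?M (copies n (mult_bimodule B UNIV UNIV))"
    and inj: "inj_on f (carr ?M)"
    and x: "\<And>i. i < n \<Longrightarrow> x i \<in> carr ?M"
    and exp: "\<And>X j. X \<in> carr ?M \<Longrightarrow> j < n \<Longrightarrow> f X j = (\<Sum>i<n. f (x i) j * f X i)"
    and comm: "\<And>i j l. i < n \<Longrightarrow> j < n \<Longrightarrow> l \<in> B \<Longrightarrow> l * f (x i) j = f (x i) j * l"
    by (rule direct_summand_frame[OF iso UNIV_I UNIV_I subset_UNIV]) blast
  have "\<exists>p. \<forall>i<n. x i = p i +o KA B"
    using x unfolding carr_AA by (intro choice) blast
  then obtain p where p: "\<And>i. i < n \<Longrightarrow> x i = p i +o KA B" by blast
  \<comment> \<open>Coordinates and both actions are moved to representatives in the free abelian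
    group, which avoids arithmetic with sets.\<close>
  define F where "F z j = f (z +o KA B) j" for z j
  define \<tau>l where "\<tau>l a = frag_extend (\<lambda>(m, n :: 'a). frag_of (a * m, n))" for a :: 'a
  define \<tau>r where "\<tau>r a = frag_extend (\<lambda>(m :: 'a, n). frag_of (m, n * a))" for a :: 'a
  have carr: "z +o KA B \<in> carr ?M" for z by (auto simp: carr_AA)
  have F_add: "F (y + z) j = F y j + F z j" for y z j
    using f carr[of y] carr[of z] by (simp add: F_def bimodule_hom_def flip: coset_plus)
  have F_zero: "F z j = 0" if "n \<le> j" for z j
    using f carr that by (auto simp: F_def bimodule_hom_def)
  have F_left: "F (\<tau>l b z) j = b * F z j" if "j < n" "b \<in> B" for b z j
    using f carr[of z] that by (simp add: F_def \<tau>l_def bimodule_hom_def flip: lact_AA[of B B UNIV])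
  have F_right: "F (\<tau>r a z) j = F z j * a" if "j < n" for a z j
    using f carr[of z] that by (simp add: F_def \<tau>r_def bimodule_hom_def flip: ract_AA[of B B UNIV])
  have F_eqD: "y +o KA B = z +o KA B" if "\<And>j. j < n \<Longrightarrow> F y j = F z j" for y z
  proof (rule inj_onD[OF inj _ carr carr], rule ext)
    fix j show "f (y +o KA B) j = f (z +o KA B) j"
      using that[of j] F_zero[of j] by (cases "j < n") (auto simp: F_def)
  qed
  have F_sum: "F (\<Sum>i<(m::nat). g i) j = (\<Sum>i<m. F (g i) j)" for g m j
  proof -
    have "F 0 j = 0" using F_add[of 0 0 j] by simp
    then show ?thesis by (induction m) (simp_all add: F_add)
  qed
  have F_cong: "F y = F z" if "y - z \<in> KA B" for y z
    using that by (simp add: F_def fun_eq_iff flip: coset_eq_iff)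
  have F_p: "F z j = (\<Sum>i<n. F (p i) j * F z i)" if "j < n" for z j
  proof -
    have "f (z +o KA B) j = (\<Sum>i<n. f (x i) j * f (z +o KA B) i)"
      by (rule exp[OF carr that])
    then show ?thesis by (simp only: F_def) (simp add: p)
  qed
  show thesis
  proof
    show "(\<lambda>a. F (frag_of (a, 1)) i) \<in> End_BAB B" if i: "i < n" for i
      unfolding End_BAB_iff
    proof (intro conjI allI ballI)
      fix a a'
      have "F (frag_of (a + a', 1)) = F (frag_of (a, 1) + frag_of (a', 1))"
        using tensor_rels.add_left[of a "mult_bimodule UNIV UNIV B" a' 1 "mult_bimodule B UNIV UNIV"]
        by (intro F_cong) (simp add: diff_diff_eq)
      then show "F (frag_of (a + a', 1)) i = F (frag_of (a, 1)) i + F (frag_of (a', 1)) i"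
        by (simp add: F_add)
    next
      fix b a assume b: "b \<in> B"
      show "F (frag_of (b * a, 1)) i = b * F (frag_of (a, 1)) i"
        using F_left[OF i b, of "frag_of (a, 1)"] by (simp add: \<tau>l_def)
      \<comment> \<open>The scalar crosses the tensor sign: ab \<otimes> 1 = a \<otimes> b = (a
        \<otimes> 1)b.\<close>
      have "F (frag_of (a * b, 1)) = F (frag_of (a, b))"
        using tensor_rels.balanced[of a "mult_bimodule UNIV UNIV B" b 1 "mult_bimodule B UNIV UNIV"] b
        by (intro F_cong) simp
      then show "F (frag_of (a * b, 1)) i = F (frag_of (a, 1)) i * b"
        using F_right[OF i, of b "frag_of (a, 1)"] by (simp add: \<tau>r_def)
    qed
    \<comment> \<open>By \<open>comm\<close> the coordinates of the frame vectors commute with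
      \<open>b\<close>, so both sides have equal coordinates.\<close>
    show "lact (AA B B B) b (p i +o KA B) = ract (AA B B B) (p i +o KA B) b"
      if "i < n" "b \<in> B" for i b
      unfolding lact_AA ract_AA \<tau>l_def[symmetric] \<tau>r_def[symmetric]
      by (rule F_eqD) (use that comm[of i _ b] in \<open>simp add: F_left F_right, simp add: F_def p\<close>)
    show "pure_tensor (mult_bimodule UNIV UNIV B) (mult_bimodule B UNIV UNIV) a a' =
      (\<Sum>i<n. ract (AA B B UNIV) (p i +o KA B) (F (frag_of (a, 1)) i * a')) + KA B" for a a'
      unfolding ract_AA sum_cosets pure_tensor_def \<tau>r_def[symmetric]
    proof (rule F_eqD)
      fix j assume j: "j < n"
      have "F (frag_of (a, a')) j = F (\<tau>r a' (frag_of (a, 1))) j" by (simp add: \<tau>r_def)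
      also have "\<dots> = (\<Sum>i<n. F (p i) j * F (frag_of (a, 1)) i * a')"
        by (simp add: F_right j F_p[OF j, of "frag_of (a, 1)"] sum_distrib_right)
      finally show "F (frag_of (a, a')) j = F (\<Sum>i<n. \<tau>r (F (frag_of (a, 1)) i * a') (p i)) j"
        by (simp add: F_sum F_right j mult.assoc)
    qed
  qed
qed

section \<open>Separability and coseparability\<close>

lemma S_bimodule_simps [simp]:
  "lring (S_bimodule B) = centralizer B" "carr (S_bimodule B) = End_BAB B"
  "rring (S_bimodule B) = centralizer B"
  "lact (S_bimodule B) r \<alpha> = (\<lambda>a. r * \<alpha> a)" "ract (S_bimodule B) \<alpha> r = (\<lambda>a. \<alpha> a * r)"
  by (simp_all add: S_bimodule_def)

lemma S_coring_simps [simp]: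
  "lring (S_coring B) = centralizer B" "carr (S_coring B) = End_BAB B"
  "rring (S_coring B) = centralizer B"
  "lact (S_coring B) = lact (S_bimodule B)" "ract (S_coring B) = ract (S_bimodule B)"
  "comult (S_coring B) = S_comult B" "counit (S_coring B) \<alpha> = \<alpha> 1"
  by (simp_all add: S_coring_def bimodule.extend_def S_bimodule_def)

lemma tensor_rels_S_coring [simp]:
  "tensor_rels (S_coring B) (S_coring B) = tensor_rels (S_bimodule B) (S_bimodule B)"
proof (intro equalityI subsetI)
  show "x \<in> tensor_rels (S_bimodule B) (S_bimodule B)"
    if "x \<in> tensor_rels (S_coring B) (S_coring B)" for x
    by (rule tensor_rels_mono[OF that]) simp_all
  show "x \<in> tensor_rels (S_coring B) (S_coring B)"
    if "x \<in> tensor_rels (S_bimodule B) (S_bimodule B)" for x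
    by (rule tensor_rels_mono[OF that]) simp_all
qed

lemma pure_tensor_S_coring [simp]:
  "pure_tensor (S_coring B) (S_coring B) = pure_tensor (S_bimodule B) (S_bimodule B)"
  by (simp add: pure_tensor_def fun_eq_iff)

lemma tensor_S_coring [simp]:
  "tensor (S_coring B) (S_coring B) = tensor (S_bimodule B) (S_bimodule B)"
  by (simp add: tensor_def)

lemma End_BAB_lmult: "\<alpha> \<in> End_BAB B \<Longrightarrow> r \<in> centralizer B \<Longrightarrow> (\<lambda>a. r * \<alpha> a) \<in> End_BAB B"
  by (simp add: End_BAB_iff centralizer_def distrib_left) (metis mult.assoc)

lemma End_BAB_rmult: "\<alpha> \<in> End_BAB B \<Longrightarrow> r \<in> centralizer B \<Longrightarrow> (\<lambda>a. \<alpha> a * r) \<in> End_BAB B"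
  by (simp add: End_BAB_iff centralizer_def distrib_right) (metis mult.assoc)

lemma id_End_BAB: "(\<lambda>a. a) \<in> End_BAB B"
  by (simp add: End_BAB_iff)

lemma lact_tensor_S:
  assumes "r \<in> centralizer B"
  shows "lact (tensor (S_bimodule B) (S_bimodule B)) r (x +o tensor_rels (S_bimodule B) (S_bimodule B)) =
    frag_extend (\<lambda>(\<xi>, \<eta>). frag_of (\<lambda>a. r * \<xi> a, \<eta>)) x +o tensor_rels (S_bimodule B) (S_bimodule B)"
  using lact_tensor_coset[of "S_bimodule B" r "S_bimodule B" x] assms
  by (simp add: End_BAB_lmult distrib_left mult.assoc fun_eq_iff)

lemma ract_tensor_S:
  assumes "r \<in> centralizer B"
  shows "ract (tensor (S_bimodule B) (S_bimodule B)) (x +o tensor_rels (S_bimodule B) (S_bimodule B)) r =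
    frag_extend (\<lambda>(\<xi>, \<eta>). frag_of (\<xi>, \<lambda>a. \<eta> a * r)) x +o tensor_rels (S_bimodule B) (S_bimodule B)"
  using ract_tensor_coset[of "S_bimodule B" r "S_bimodule B" x] assms
  by (simp add: End_BAB_rmult distrib_right mult.assoc fun_eq_iff)

lemma free_lift_lact:
  "free_lift (case_prod f) (frag_extend (\<lambda>(m, n). frag_of (g m, n)) x) = free_lift (\<lambda>(m, n). f (g m) n) x"
  using free_lift_frag_extend[of "case_prod f" "\<lambda>(m, n). (g m, n)" x]
  by (simp add: case_prod_unfold comp_def)

lemma free_lift_ract:
  "free_lift (case_prod f) (frag_extend (\<lambda>(m, n). frag_of (m, g n)) x) = free_lift (\<lambda>(m, n). f m (g n)) x"
  using free_lift_frag_extend[of "case_prod f" "\<lambda>(m, n). (m, g n)" x]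
  by (simp add: case_prod_unfold comp_def)

text \<open>One quasibase is fed into \<open>S_comult_quasibase\<close> and kept fixed, with the
  coproduct written as the coset of an explicit element of the free abelian group. The last three
  properties characterise the coproduct by evaluation.\<close>

lemma depth_two_comult:
  assumes "depth_two B"
  obtains n :: nat and p \<beta> where
    "\<And>i. i < n \<Longrightarrow> \<beta> i \<in> End_BAB B"
    "\<And>a a'. pure_tensor (mult_bimodule UNIV UNIV B) (mult_bimodule B UNIV UNIV) a a' =
      (\<Sum>i<n. ract (AA B B UNIV) (p i +o KA B) (\<beta> i a * a')) + KA B"
    "\<And>\<alpha>. \<alpha> \<in> End_BAB B \<Longrightarrow> S_comult B \<alpha> =
      (\<Sum>i<n. frag_of (\<lambda>a. free_lift (\<lambda>(u, v). \<alpha> (a * u) * v) (p i), \<beta> i)) +o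
        tensor_rels (S_bimodule B) (S_bimodule B)"
    "\<And>\<alpha>. \<alpha> \<in> End_BAB B \<Longrightarrow> S_comult B \<alpha> \<in> carr (tensor (S_bimodule B) (S_bimodule B))"
    "\<And>\<alpha> a a'. \<alpha> \<in> End_BAB B \<Longrightarrow> tensor_lift (\<lambda>\<xi> \<eta>. \<xi> a * \<eta> a') (S_comult B \<alpha>) = \<alpha> (a * a')"
    "\<And>\<alpha> X. \<alpha> \<in> End_BAB B \<Longrightarrow> X \<in> carr (tensor (S_bimodule B) (S_bimodule B)) \<Longrightarrow>
      (\<And>a a'. tensor_lift (\<lambda>\<xi> \<eta>. \<xi> a * \<eta> a') X = \<alpha> (a * a')) \<Longrightarrow> X = S_comult B \<alpha>"
proof -
  obtain n :: nat and p \<beta> where \<beta>: "\<And>i. i < n \<Longrightarrow> \<beta> i \<in> End_BAB B"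
    and pB: "\<And>i b. i < n \<Longrightarrow> b \<in> B \<Longrightarrow>
      lact (AA B B B) b (p i +o KA B) = ract (AA B B B) (p i +o KA B) b"
    and qb: "\<And>a a'. pure_tensor (mult_bimodule UNIV UNIV B) (mult_bimodule B UNIV UNIV) a a' =
      (\<Sum>i<n. ract (AA B B UNIV) (p i +o KA B) (\<beta> i a * a')) + KA B"
    by (rule depth_two_quasibase[OF assms]) blast
  have p: "p i +o KA B \<in> carr (AA B B B)" for i by (auto simp: carr_AA)
  let ?D = "\<lambda>\<alpha>. (\<Sum>i<n. pure_tensor (S_bimodule B) (S_bimodule B)
      (\<lambda>a. tensor_lift (\<lambda>x y. \<alpha> (a * x) * y) (p i +o KA B)) (\<beta> i)) +
      tensor_rels (S_bimodule B) (S_bimodule B)"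
  have D: "S_comult B \<alpha> = ?D \<alpha>" if "\<alpha> \<in> End_BAB B" for \<alpha>
    by (rule S_comult_quasibase(1)) (simp_all only: p pB \<beta> qb that)
  show thesis
  proof
    fix \<alpha> assume \<alpha>: "\<alpha> \<in> End_BAB B"
    have "(\<lambda>a. tensor_lift (\<lambda>u v. \<alpha> (a * u) * v) (p i +o KA B)) =
        (\<lambda>a. free_lift (\<lambda>(u, v). \<alpha> (a * u) * v) (p i))" for i
      unfolding fun_eq_iff using \<alpha>
      by (intro allI tensor_lift_AA) (simp_all add: End_BAB_iff algebra_simps flip: mult.assoc)
    then show "S_comult B \<alpha> = (\<Sum>i<n. frag_of (\<lambda>a. free_lift (\<lambda>(u, v). \<alpha> (a * u) * v) (p i), \<beta> i)) +o
        tensor_rels (S_bimodule B) (S_bimodule B)"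
      unfolding D[OF \<alpha>] pure_tensor_def by (simp add: sum_cosets)
    show "S_comult B \<alpha> \<in> carr (tensor (S_bimodule B) (S_bimodule B))"
      unfolding D[OF \<alpha>] by (rule S_comult_quasibase(2)) (simp_all only: p pB \<beta> qb \<alpha>)
    show "tensor_lift (\<lambda>\<xi> \<eta>. \<xi> a * \<eta> a') (S_comult B \<alpha>) = \<alpha> (a * a')" for a a'
      unfolding D[OF \<alpha>] by (rule S_comult_quasibase(3)) (simp_all only: p pB \<beta> qb \<alpha>)
    show "X = S_comult B \<alpha>" if "X \<in> carr (tensor (S_bimodule B) (S_bimodule B))"
      "\<And>a a'. tensor_lift (\<lambda>\<xi> \<eta>. \<xi> a * \<eta> a') X = \<alpha> (a * a')" for X
      unfolding D[OF \<alpha>] by (rule S_comult_quasibase(4)) (simp_all only: p pB \<beta> qb \<alpha> that)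
  qed (rule \<beta> qb; assumption)+
qed

text \<open>The element \<open>y\<close> is the formal counterpart of a choice of summands in
  Sweedler notation for the coproduct.\<close>

lemma S_comult_representative:
  assumes "depth_two B" "\<alpha> \<in> End_BAB B"
  obtains y where "S_comult B \<alpha> = y +o tensor_rels (S_bimodule B) (S_bimodule B)"
    "Poly_Mapping.keys y \<subseteq> End_BAB B \<times> End_BAB B"
    "\<And>a a'. free_lift (\<lambda>(\<xi>, \<eta>). \<xi> a * \<eta> a') y = \<alpha> (a * a')"
proof -
  have carr: "S_comult B \<alpha> \<in> carr (tensor (S_bimodule B) (S_bimodule B))"
    and ev: "\<And>a a'. tensor_lift (\<lambda>\<xi> \<eta>. \<xi> a * \<eta> a') (S_comult B \<alpha>) = \<alpha> (a * a')"
    by (rule depth_two_comult[OF assms(1)], simp only: assms(2))+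
  obtain y where y: "S_comult B \<alpha> = y +o tensor_rels (S_bimodule B) (S_bimodule B)"
    "Poly_Mapping.keys y \<subseteq> End_BAB B \<times> End_BAB B"
    using carr by (auto simp: tensor_def)
  have "free_lift (\<lambda>(\<xi>, \<eta>). \<xi> a * \<eta> a') y = \<alpha> (a * a')" for a a'
    using ev[of a a'] by (simp only: y(1) tensor_lift_S)
  with y show thesis by (rule that)
qed

text \<open>Being balanced, \<open>f\<close> induces an additive map on A \<otimes> A over B.
  Applying it to both sides of the first assumption turns an identity of cosets into one of sums
  over a representative.\<close>

lemma free_lift_casimir:
  assumes "lact (AA L B R) a (E +o KA B) = ract (AA L B R) (E +o KA B) a"
    and "\<And>x x' y. f (x + x') y = f x y + f x' y" "\<And>x y y'. f x (y + y') = f x y + f x y'"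
    and "\<And>x b y. b \<in> B \<Longrightarrow> f (x * b) y = f x (b * y)"
  shows "free_lift (\<lambda>(m, n). f (a * m) n) E = free_lift (\<lambda>(m, n). f m (n * a)) E"
proof -
  have "tensor_lift f (lact (AA L B R) a (E +o KA B)) = tensor_lift f (ract (AA L B R) (E +o KA B) a)"
    by (simp only: assms(1))
  then show ?thesis
    by (simp add: lact_AA ract_AA tensor_lift_AA assms(2-4) free_lift_lact free_lift_ract)
qed

section \<open>From a separability element to a cointegral\<close>

lemma separable_imp_coseparable:
  fixes B :: "'a::{ring,monoid_mult} set"
  assumes D2: "depth_two B" and "separable_extension B"
  shows "coseparable (S_coring B)"
proof -
  let ?S = "S_bimodule B" and ?K = "tensor_rels (S_bimodule B) (S_bimodule B)"
  obtain E where cas: "\<And>a. lact (AA UNIV B UNIV) a (E +o KA B) = ract (AA UNIV B UNIV) (E +o KA B) a"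
    and "tensor_lift (*) (E +o KA B) = 1"
    using assms(2) by (auto simp: separable_extension_def carr_AA)
  then have one: "free_lift (\<lambda>(m, n). m * n) E = 1"
    by (simp add: tensor_lift_AA distrib_left distrib_right mult.assoc)
  define ev where "ev \<alpha> \<beta> = free_lift (\<lambda>(m, n). \<alpha> m * \<beta> n) E" for \<alpha> \<beta> :: "'a \<Rightarrow> 'a"
  have ev_add: "ev (\<alpha> + \<alpha>') \<beta> = ev \<alpha> \<beta> + ev \<alpha>' \<beta>" "ev \<alpha> (\<beta> + \<beta>') = ev \<alpha> \<beta> + ev \<alpha> \<beta>'"
    for \<alpha> \<alpha>' \<beta> \<beta>'
    by (simp_all add: ev_def distrib_left distrib_right case_prod_unfold free_lift_add_fun)
  have ev_left: "ev (\<lambda>a. r * \<alpha> a) \<beta> = r * ev \<alpha> \<beta>" for r \<alpha> \<beta>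
    by (simp add: ev_def mult.assoc free_lift_mult_left)
  have ev_right: "ev \<alpha> (\<lambda>a. \<beta> a * r) = ev \<alpha> \<beta> * r" for r \<alpha> \<beta>
    by (simp add: ev_def free_lift_mult_right flip: mult.assoc)
  have ev_mid: "ev (\<lambda>a. \<alpha> a * r) \<beta> = ev \<alpha> (\<lambda>a. r * \<beta> a)" for r \<alpha> \<beta>
    by (simp add: ev_def mult.assoc)
  \<comment> \<open>A scalar from B enters through the left linearity of \<alpha>, passes from the
    first leg of \<open>E\<close> to the second by \<open>cas\<close>, and leaves through the right
    linearity of \<beta>.\<close>
  have ev_cent: "ev \<alpha> \<beta> \<in> centralizer B" if S: "\<alpha> \<in> End_BAB B" "\<beta> \<in> End_BAB B" for \<alpha> \<beta>
  proof -
    have "ev \<alpha> \<beta> * b = b * ev \<alpha> \<beta>" if b: "b \<in> B" for b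
    proof -
      have "b * ev \<alpha> \<beta> = free_lift (\<lambda>(m, n). \<alpha> (b * m) * \<beta> n) E"
        using S b by (simp add: End_BAB_iff flip: ev_left) (simp add: ev_def)
      also have "\<dots> = free_lift (\<lambda>(m, n). \<alpha> m * \<beta> (n * b)) E"
        using S by (intro free_lift_casimir[OF cas]) (simp_all add: End_BAB_iff algebra_simps)
      also have "\<dots> = ev \<alpha> \<beta> * b"
        using S b by (simp add: End_BAB_iff flip: ev_right) (simp add: ev_def)
      finally show ?thesis by simp
    qed
    then show ?thesis by (simp add: centralizer_def)
  qed
  have ev_bal: "balanced_map ?S ?S ev"
    by (simp add: balanced_map_def ev_add ev_mid)
  note lift_ev = tensor_lift_coset[OF ev_bal]
  have lift_cent: "free_lift (case_prod ev) x \<in> centralizer B"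
    if "Poly_Mapping.keys x \<subseteq> End_BAB B \<times> End_BAB B" for x
    using that
  proof (induction x rule: frag_induction)
    case zero
    show ?case by (simp add: centralizer_def)
  next
    case (one z)
    then show ?case using ev_cent by auto
  next
    case (diff x y)
    then show ?case by (simp add: free_lift_diff centralizer_def algebra_simps)
  qed
  have hom: "tensor_lift ev \<in> bimodule_hom (tensor ?S ?S)
      (mult_bimodule (centralizer B) (centralizer B) (centralizer B))"
  proof -
    have carr: "\<exists>x. X = x +o ?K \<and> Poly_Mapping.keys x \<subseteq> End_BAB B \<times> End_BAB B"
      if "X \<in> carr (tensor ?S ?S)" for X
      using that by (auto simp: tensor_def)
    show ?thesis
      unfolding bimodule_hom_def mem_Collect_eq tensor_scalars S_bimodule_simps(1,3) mult_bimodule_simps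
    proof (intro conjI ballI)
      fix X assume "X \<in> carr (tensor ?S ?S)"
      then obtain x where x: "X = x +o ?K" "Poly_Mapping.keys x \<subseteq> End_BAB B \<times> End_BAB B"
        using carr by blast
      show "tensor_lift ev X \<in> centralizer B"
        using lift_cent[OF x(2)] by (simp add: x(1) lift_ev)
      show "tensor_lift ev (X + Y) = tensor_lift ev X + tensor_lift ev Y"
        if "Y \<in> carr (tensor ?S ?S)" for Y
        using carr[OF that] by (auto simp: x(1) coset_plus lift_ev free_lift_add)
      show "tensor_lift ev (lact (tensor ?S ?S) r X) = r * tensor_lift ev X"
        if "r \<in> centralizer B" for r
        using that by (simp add: x(1) lact_tensor_S lift_ev free_lift_lact ev_left free_lift_mult_left)
      show "tensor_lift ev (ract (tensor ?S ?S) X r) = tensor_lift ev X * r"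
        if "r \<in> centralizer B" for r
        using that by (simp add: x(1) ract_tensor_S lift_ev free_lift_ract ev_right free_lift_mult_right)
    qed
  qed
  have counit: "tensor_lift ev (S_comult B c) = c 1" if c: "c \<in> End_BAB B" for c
  proof -
    obtain y where y: "S_comult B c = y +o ?K"
      "\<And>a a'. free_lift (\<lambda>(\<xi>, \<eta>). \<xi> a * \<eta> a') y = c (a * a')"
      using S_comult_representative[OF D2 c] by metis
    \<comment> \<open>After the two sums are exchanged, the inner one is \<open>c\<close> applied to
      the product of the two legs of \<open>E\<close>; additivity of \<open>c\<close> then reduces
      everything to \<open>one\<close>.\<close>
    have "tensor_lift ev (S_comult B c) = free_lift (\<lambda>q. free_lift (\<lambda>z. fst q (fst z) * snd q (snd z)) E) y"
      by (simp add: y(1) lift_ev ev_def case_prod_unfold)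
    also have "\<dots> = free_lift (\<lambda>z. c (fst z * snd z)) E"
      using y(2) by (subst free_lift_swap) (simp add: case_prod_unfold)
    also have "\<dots> = c (free_lift (\<lambda>z. fst z * snd z) E)"
      using c by (intro free_lift_additive[symmetric]) (simp add: End_BAB_iff)
    also have "\<dots> = c 1" using one by (simp add: case_prod_unfold)
    finally show ?thesis .
  qed
  have cosep: "tensor_lift (\<lambda>x y. ract ?S x (tensor_lift ev (pure_tensor ?S ?S y c'))) (S_comult B c) =
      tensor_lift (\<lambda>x y. lact ?S (tensor_lift ev (pure_tensor ?S ?S c x)) y) (S_comult B c')"
    if c: "c \<in> End_BAB B" and c': "c' \<in> End_BAB B" for c c'
  proof
    fix a
    obtain y where y: "S_comult B c = y +o ?K"
      "\<And>a a'. free_lift (\<lambda>(\<xi>, \<eta>). \<xi> a * \<eta> a') y = c (a * a')"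
      using S_comult_representative[OF D2 c] by metis
    obtain y' where y': "S_comult B c' = y' +o ?K"
      "\<And>a a'. free_lift (\<lambda>(\<xi>, \<eta>). \<xi> a * \<eta> a') y' = c' (a * a')"
      using S_comult_representative[OF D2 c'] by metis
    \<comment> \<open>Both sides of the coseparability condition are functions on A, so the lifts
      take values in functions; \<open>free_lift_fun_apply\<close> evaluates them at
      \<open>a\<close>.\<close>
    have bal: "balanced_map ?S ?S (\<lambda>\<xi> \<eta> a. \<xi> a * ev \<eta> c')" "balanced_map ?S ?S (\<lambda>\<xi> \<eta> a. ev c \<xi> * \<eta> a)"
      by (auto simp: balanced_map_def ev_add ev_left ev_right algebra_simps)
    \<comment> \<open>Write \<open>m\<close>, \<open>n\<close> for the legs of \<open>E\<close>. The
      left side collapses to the sum of \<open>c (a * m) * c' n\<close>, the right side to that of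
      \<open>c m * c' (n * a)\<close>, and \<open>cas\<close> identifies the two.\<close>
    have "tensor_lift (\<lambda>x y. ract ?S x (tensor_lift ev (pure_tensor ?S ?S y c'))) (S_comult B c) a =
        free_lift (\<lambda>q. fst q a * ev (snd q) c') y"
      by (simp add: tensor_lift_pure_tensor[OF ev_bal] y(1) tensor_lift_coset[OF bal(1)]
          free_lift_fun_apply case_prod_unfold)
    also have "\<dots> = free_lift (\<lambda>q. free_lift (\<lambda>z. fst q a * snd q (fst z) * c' (snd z)) E) y"
      using free_lift_mult_left[of _ "\<lambda>u v. _ u * c' v" E]
      by (simp add: ev_def case_prod_unfold mult.assoc)
    also have "\<dots> = free_lift (\<lambda>z. free_lift (\<lambda>q. fst q a * snd q (fst z) * c' (snd z)) y) E"
      by (rule free_lift_swap)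
    also have "\<dots> = free_lift (\<lambda>(m, n). c (a * m) * c' n) E"
      using y(2) free_lift_mult_right[of "\<lambda>\<xi> \<eta>. \<xi> a * \<eta> _" _ y]
      by (simp add: case_prod_unfold)
    also have "\<dots> = free_lift (\<lambda>(m, n). c m * c' (n * a)) E"
      using c c' by (intro free_lift_casimir[OF cas]) (simp_all add: End_BAB_iff algebra_simps)
    also have "\<dots> = free_lift (\<lambda>z. free_lift (\<lambda>q. c (fst z) * (fst q (snd z) * snd q a)) y') E"
      using y'(2) free_lift_mult_left[of _ "\<lambda>\<xi> \<eta>. \<xi> _ * \<eta> a" y']
      by (simp add: case_prod_unfold)
    also have "\<dots> = free_lift (\<lambda>q. free_lift (\<lambda>z. c (fst z) * (fst q (snd z) * snd q a)) E) y'"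
      by (rule free_lift_swap)
    also have "\<dots> = free_lift (\<lambda>q. ev c (fst q) * snd q a) y'"
      using free_lift_mult_right[of "\<lambda>u v. c u * _ v" _ E]
      by (simp add: ev_def case_prod_unfold flip: mult.assoc)
    also have "\<dots> = tensor_lift (\<lambda>x y. lact ?S (tensor_lift ev (pure_tensor ?S ?S c x)) y) (S_comult B c') a"
      by (simp add: tensor_lift_pure_tensor[OF ev_bal] y'(1) tensor_lift_coset[OF bal(2)]
          free_lift_fun_apply case_prod_unfold)
    finally show "tensor_lift (\<lambda>x y. ract ?S x (tensor_lift ev (pure_tensor ?S ?S y c'))) (S_comult B c) a =
      tensor_lift (\<lambda>x y. lact ?S (tensor_lift ev (pure_tensor ?S ?S c x)) y) (S_comult B c') a" .
  qed
  show ?thesis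
    unfolding coseparable_def tensor_S_coring pure_tensor_S_coring S_coring_simps
    using hom counit cosep by blast
qed

section \<open>From a cointegral to a separability element\<close>

text \<open>For a pure tensor, expand u in the dual basis and move the coefficients \<phi> k u,
  which lie in B, across the tensor sign; additivity does the rest. Hence the maps u \<otimes> v
  \<mapsto> \<phi> k u * v jointly detect equality of tensors.\<close>

lemma coset_dual_basis:
  fixes n :: nat
  assumes \<phi>: "\<And>k a. k < n \<Longrightarrow> \<phi> k a \<in> B"
    and dual: "\<And>a. (\<Sum>k<n. x k * \<phi> k a) = a"
  shows "z +o KA B = (\<Sum>k<n. frag_of (x k, free_lift (\<lambda>(u, v). \<phi> k u * v) z)) +o KA B"
proof -
  let ?M = "mult_bimodule UNIV UNIV B" and ?N = "mult_bimodule B UNIV UNIV"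
  let ?f = "\<lambda>z k. free_lift (\<lambda>(u, v). \<phi> k u * v) z"
  \<comment> \<open>The generator \<open>frag_of (u, 0)\<close> is nonzero in the free group; the
    relation for 0 + 0 is its negative.\<close>
  have zero_right: "frag_of (u, 0) \<in> KA B" for u
    using tensor_rels.add_right[of u ?M 0 ?N 0] tensor_rels_minus by force
  have zero_left: "frag_of (0, v) \<in> KA B" for v
    using tensor_rels.add_left[of 0 ?M 0 v ?N] tensor_rels_minus by force
  have sum_left: "frag_of (\<Sum>k<m. g k, v) - (\<Sum>k<m. frag_of (g k, v)) \<in> KA B" for m :: nat and g v
  proof (induction m)
    case (Suc m)
    show ?case
      using tensor_rels_add[OF Suc tensor_rels.add_left[of "\<Sum>k<m. g k" ?M "g m" v ?N]]
      by (simp add: algebra_simps)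
  qed (simp add: zero_left)
  have "Poly_Mapping.keys z \<subseteq> UNIV" by simp
  then have "z - (\<Sum>k<n. frag_of (x k, ?f z k)) \<in> KA B"
  proof (induction z rule: frag_induction)
    case zero
    have "(\<Sum>k<n. frag_of (x k, 0)) \<in> KA B" by (intro tensor_rels_sum zero_right)
    then show ?case using tensor_rels_minus by fastforce
  next
    case (one z)
    obtain u v where z: "z = (u, v)" by fastforce
    have "(\<Sum>k<n. frag_of (x k * \<phi> k u, v) - frag_of (x k, \<phi> k u * v)) \<in> KA B"
      using tensor_rels.balanced[of _ ?M _ v ?N] \<phi> by (intro tensor_rels_sum) simp
    from tensor_rels_add[OF sum_left[where g = "\<lambda>k. x k * \<phi> k u" and m = n and v = v] this] show ?case
      by (simp add: z dual sum_subtractf)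
  next
    case (diff y z)
    \<comment> \<open>The relations concern sums, so the difference is treated through y = (y - z) +
      z.\<close>
    have "(\<Sum>k<n. frag_of (x k, ?f y k) - frag_of (x k, ?f (y - z) k) - frag_of (x k, ?f z k)) \<in> KA B"
    proof (rule tensor_rels_sum)
      show "frag_of (x k, ?f y k) - frag_of (x k, ?f (y - z) k) - frag_of (x k, ?f z k) \<in> KA B" for k
        using tensor_rels.add_right[of "x k" ?M "?f (y - z) k" ?N "?f z k"]
        by (simp add: free_lift_diff)
    qed
    from tensor_rels_add[OF this tensor_rels.diff[OF diff.IH]] show ?case
      by (simp add: sum_subtractf sum.distrib algebra_simps)
  qed
  then show ?thesis by (simp only: coset_eq_iff)
qed

lemma coseparable_imp_separable:
  fixes B :: "'a::{ring,monoid_mult} set"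
  assumes B: "unital_subring B" and D2: "depth_two B" and fgp: "right_fg_projective B"
    and cosep: "coseparable (S_coring B)"
  shows "separable_extension B"
proof -
  let ?S = "S_bimodule B" and ?K = "tensor_rels (S_bimodule B) (S_bimodule B)" and ?id = "\<lambda>a::'a. a"
  obtain \<gamma> where \<gamma>: "\<gamma> \<in> bimodule_hom (tensor ?S ?S)
      (mult_bimodule (centralizer B) (centralizer B) (centralizer B))"
    and \<gamma>_counit: "\<And>c. c \<in> End_BAB B \<Longrightarrow> \<gamma> (S_comult B c) = c 1"
    and \<gamma>_cosep: "\<And>c c'. c \<in> End_BAB B \<Longrightarrow> c' \<in> End_BAB B \<Longrightarrow>
      tensor_lift (\<lambda>x y a. x a * \<gamma> (pure_tensor ?S ?S y c')) (S_comult B c) =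
      tensor_lift (\<lambda>x y a. \<gamma> (pure_tensor ?S ?S c x) * y a) (S_comult B c')"
    using cosep
    unfolding coseparable_def tensor_S_coring pure_tensor_S_coring S_coring_simps S_bimodule_simps
    by blast
  define g where "g \<alpha> \<beta> = \<gamma> (pure_tensor ?S ?S \<alpha> \<beta>)" for \<alpha> \<beta>
  \<comment> \<open>Membership in \<open>End_BAB B\<close> is required because \<gamma> is
    constrained only on the carrier of the tensor square.\<close>
  have g_add: "g (\<alpha> + \<alpha>') \<beta> = g \<alpha> \<beta> + g \<alpha>' \<beta>" "g \<beta> (\<alpha> + \<alpha>') = g \<beta> \<alpha> + g \<beta> \<alpha>'"
    if "\<alpha> \<in> End_BAB B" "\<alpha>' \<in> End_BAB B" "\<beta> \<in> End_BAB B" for \<alpha> \<alpha>' \<beta>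
    using \<gamma> that
    by (simp_all add: g_def pure_tensor_add_left pure_tensor_add_right bimodule_hom_def pure_tensor_in_carr)
  have g_left: "g (\<lambda>a. r * \<alpha> a) \<beta> = r * g \<alpha> \<beta>"
    if "\<alpha> \<in> End_BAB B" "\<beta> \<in> End_BAB B" "r \<in> centralizer B" for r \<alpha> \<beta>
  proof -
    have "pure_tensor ?S ?S (\<lambda>a. r * \<alpha> a) \<beta> = lact (tensor ?S ?S) r (pure_tensor ?S ?S \<alpha> \<beta>)"
      using that by (simp add: pure_tensor_def lact_tensor_S)
    then show ?thesis
      using \<gamma> that by (simp add: g_def bimodule_hom_def pure_tensor_in_carr)
  qed
  have g_right: "g \<beta> (\<lambda>a. \<alpha> a * r) = g \<beta> \<alpha> * r"
    if "\<alpha> \<in> End_BAB B" "\<beta> \<in> End_BAB B" "r \<in> centralizer B" for r \<alpha> \<beta>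
  proof -
    have "pure_tensor ?S ?S \<beta> (\<lambda>a. \<alpha> a * r) = ract (tensor ?S ?S) (pure_tensor ?S ?S \<beta> \<alpha>) r"
      using that by (simp add: pure_tensor_def ract_tensor_S)
    then show ?thesis
      using \<gamma> that by (simp add: g_def bimodule_hom_def pure_tensor_in_carr)
  qed
  obtain n :: nat and p \<beta> where \<beta>: "\<And>i. i < n \<Longrightarrow> \<beta> i \<in> End_BAB B"
    and qb: "\<And>a a'. pure_tensor (mult_bimodule UNIV UNIV B) (mult_bimodule B UNIV UNIV) a a' =
      (\<Sum>i<n. ract (AA B B UNIV) (p i +o KA B) (\<beta> i a * a')) + KA B"
    and comult: "\<And>\<alpha>. \<alpha> \<in> End_BAB B \<Longrightarrow> S_comult B \<alpha> =
      (\<Sum>i<n. frag_of (\<lambda>a. free_lift (\<lambda>(u, v). \<alpha> (a * u) * v) (p i), \<beta> i)) +o ?K"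
    and comult_unique: "\<And>\<alpha> X. \<alpha> \<in> End_BAB B \<Longrightarrow> X \<in> carr (tensor ?S ?S) \<Longrightarrow>
      (\<And>a a'. tensor_lift (\<lambda>\<xi> \<eta>. \<xi> a * \<eta> a') X = \<alpha> (a * a')) \<Longrightarrow> X = S_comult B \<alpha>"
    by (rule depth_two_comult[OF D2]) blast
  define \<rho> where "\<rho> c i a = free_lift (\<lambda>(u, v). c (a * u) * v) (p i)" for c :: "'a \<Rightarrow> 'a" and i a
  have comult_\<rho>: "S_comult B c = (\<Sum>i<n. frag_of (\<rho> c i, \<beta> i)) +o ?K" if c: "c \<in> End_BAB B" for c
    using comult[OF c] by (simp add: \<rho>_def[abs_def])
  \<comment> \<open>Evaluated at a and a', the tensor id \<otimes> id gives the product a * a',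
    which is the value that characterises the coproduct of the identity.\<close>
  have comult_id: "S_comult B ?id = pure_tensor ?S ?S ?id ?id"
    by (rule comult_unique[OF id_End_BAB, symmetric])
      (simp_all add: pure_tensor_in_carr id_End_BAB, simp add: pure_tensor_def tensor_lift_S)
  have g_id: "g ?id ?id = 1"
    using \<gamma>_counit[OF id_End_BAB] by (simp add: g_def comult_id)
  have cosep_id: "(\<Sum>i<n. \<rho> c i a * g (\<beta> i) ?id) = g c ?id * a" if c: "c \<in> End_BAB B" for c a
  proof -
    have bal: "balanced_map ?S ?S (\<lambda>x y a. x a * g y ?id)"
      by (auto simp: balanced_map_def id_End_BAB g_add g_left algebra_simps)
    have bal': "balanced_map ?S ?S (\<lambda>x y a. g c x * y a)"
      using c by (auto simp: balanced_map_def g_add g_right algebra_simps)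
    have "(\<Sum>i<n. \<rho> c i a * g (\<beta> i) ?id) =
        tensor_lift (\<lambda>x y a. x a * g y ?id) (S_comult B c) a"
      by (simp add: comult_\<rho>[OF c] tensor_lift_coset[OF bal] free_lift_sum sum_fun_apply)
    also have "\<dots> = tensor_lift (\<lambda>x y a. g c x * y a) (S_comult B ?id) a"
      using \<gamma>_cosep[OF c id_End_BAB] by (simp add: g_def)
    also have "\<dots> = g c ?id * a"
      by (simp add: comult_id tensor_lift_pure_tensor[OF bal'])
    finally show ?thesis .
  qed
  \<comment> \<open>This represents the sum of the quasibase tensors, each multiplied on its right
    leg by the scalar \<open>g (\<beta> i) ?id\<close>.\<close>
  define E where "E = (\<Sum>i<n. frag_extend (\<lambda>(u, v). frag_of (u, v * g (\<beta> i) ?id)) (p i))"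
  have lift_E: "free_lift (\<lambda>(u, v). f u * v) E = (\<Sum>i<n. free_lift (\<lambda>(u, v). f u * v) (p i) * g (\<beta> i) ?id)"
    for f :: "'a \<Rightarrow> 'a"
    unfolding E_def free_lift_sum free_lift_ract
    by (simp add: free_lift_mult_right flip: mult.assoc)
  \<comment> \<open>At 1, \<open>cosep_id\<close> identifies \<open>g c ?id\<close> with the sum
    over \<open>E\<close> of \<open>c u * v\<close>; substituting this into the instance at
    \<open>a\<close> gives the claim.\<close>
  have S_casimir: "free_lift (\<lambda>(u, v). c (a * u) * v) E = free_lift (\<lambda>(u, v). c u * v) E * a"
    if "c \<in> End_BAB B" for c a
    using cosep_id[OF that, of a] cosep_id[OF that, of 1] by (simp add: lift_E \<rho>_def)
  have E_one: "free_lift (\<lambda>(u, v). u * v) E = 1"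
    using cosep_id[OF id_End_BAB, of 1] lift_E[of ?id] by (simp add: \<rho>_def g_id)
  have casimir: "free_lift (\<lambda>(u, v). f (a * u) * v) E = free_lift (\<lambda>(u, v). f u * v) E * a"
    if f: "\<And>x y. f (x + y) = f x + f y" "\<And>x b. b \<in> B \<Longrightarrow> f (x * b) = f x * b" for f a
  proof -
    define s where "s i = free_lift (\<lambda>(u, v). f u * v) (p i)" for i
    have f_expand: "f a = (\<Sum>i<n. s i * \<beta> i a)" for a
    proof -
      \<comment> \<open>The map u \<otimes> v \<mapsto> f u * v, balanced by right B-linearity of
        \<open>f\<close>, is applied to the quasibase expansion of a \<otimes> 1.\<close>
      have "frag_of (a, 1) +o KA B = (\<Sum>i<n. frag_extend (\<lambda>(u, v). frag_of (u, v * \<beta> i a)) (p i)) +o KA B"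
        using qb[of a 1] by (simp add: pure_tensor_def ract_AA sum_cosets)
      then have "tensor_lift (\<lambda>u v. f u * v) (frag_of (a, 1) +o KA B) = tensor_lift (\<lambda>u v. f u * v) \<dots>"
        by simp
      then show ?thesis
        using f by (simp add: tensor_lift_AA algebra_simps free_lift_sum free_lift_ract s_def)
          (simp add: free_lift_mult_right flip: mult.assoc)
    qed
    \<comment> \<open>The coefficients \<open>s i\<close> stand on the left and do not depend on
      \<open>a\<close>, so \<open>S_casimir\<close> for each \<beta> i carries over to
      \<open>f\<close>. As before, the instances at \<open>a\<close> and at 1 are compared.\<close>
    have "free_lift (\<lambda>(u, v). f (a * u) * v) E = (\<Sum>i<n. s i * free_lift (\<lambda>(u, v). \<beta> i (a * u) * v) E)" for a
    proof -
      have "free_lift (\<lambda>(u, v). f (a * u) * v) E = free_lift (\<lambda>z. \<Sum>i<n. case z of (u, v) \<Rightarrow> s i * (\<beta> i (a * u) * v)) E"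
        by (simp add: f_expand sum_distrib_right case_prod_unfold mult.assoc)
      then show ?thesis by (simp add: free_lift_sum_fun free_lift_mult_left)
    qed
    from this[of a] this[of 1] show ?thesis
      by (simp add: S_casimir \<beta> sum_distrib_right mult.assoc)
  qed
  obtain m :: nat and x \<phi> where \<phi>: "\<And>k a. k < m \<Longrightarrow> \<phi> k a \<in> B"
    "\<And>k a a'. k < m \<Longrightarrow> \<phi> k (a + a') = \<phi> k a + \<phi> k a'"
    "\<And>k a b. k < m \<Longrightarrow> b \<in> B \<Longrightarrow> \<phi> k (a * b) = \<phi> k a * b"
    and dual: "\<And>a. (\<Sum>k<m. x k * \<phi> k a) = a"
    by (rule right_fg_projective_dual_basis[OF B fgp]) blast
  have "lact (AA UNIV B UNIV) a (E +o KA B) = ract (AA UNIV B UNIV) (E +o KA B) a" for a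
  proof -
    let ?f = "\<lambda>k. free_lift (\<lambda>(u, v). \<phi> k u * v)"
    \<comment> \<open>Each \<phi> k is additive and right B-linear, so \<open>casimir\<close>
      applies; \<open>coset_dual_basis\<close> then lifts the equality of all these images to the
      tensors themselves.\<close>
    have "?f k (frag_extend (\<lambda>(u, v). frag_of (a * u, v)) E) =
        ?f k (frag_extend (\<lambda>(u, v). frag_of (u, v * a)) E)" if "k < m" for k
      using casimir[of "\<phi> k" a] \<phi>(2,3) that
      by (simp add: free_lift_lact free_lift_ract) (simp add: free_lift_mult_right flip: mult.assoc)
    then show ?thesis
      unfolding lact_AA ract_AA
      by (subst (1 2) coset_dual_basis[where \<phi> = \<phi> and x = x and n = m, OF \<phi>(1) dual]) simp_all
  qed
  moreover have "tensor_lift (*) (E +o KA B) = 1"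
    using E_one by (simp add: tensor_lift_AA distrib_left distrib_right mult.assoc)
  ultimately show ?thesis by (auto simp: separable_extension_def carr_AA)
qed

theorem theorem3p1:
  fixes B :: "'a::{ring,monoid_mult} set"
  assumes "unital_subring B"
    and "depth_two B"
    and "right_fg_projective B"
  shows "separable_extension B \<longleftrightarrow> coseparable (S_coring B)"
  using separable_imp_coseparable[OF assms(2)] coseparable_imp_separable[OF assms] by blast

end
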